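(* (a) Let $q$ be a prime power, let $n\ge 5$, and let $G$ be a subgroup of $\mathrm{P\Gamma L}(n,q)$ containing $\mathrm{PSL}(n,q)$, acting on the set of lines of the projective space. Then $G$ is almost synchronizing. (b) Let $p$ be an odd prime and let $G$ be the semidirect product of the additive group of $\mathrm{GF}(p^2)$ by the subgroup of index $2$ in the multiplicative group of the field $\mathrm{GF}(p^2)$. Then $G$ (acting on $\mathrm{GF}(p^2)$) is almost synchronizing. (c) Let $q$ be a power of $2$ (with $q\ge 2$) and let $G$ be the symplectic group $\mathrm{PSp}(4,q)$, or a group obtained from it by adjoining field automorphisms, acting on the points of the symplectic generalized quadrangle $W(q)$. Then $G$ is almost synchronizing.
   Context: For a finite set $X$, the kernel of a map $t:X\to X$ is the partition of $X$ in which $x,y$ lie in the same block iff they have the same image under $t$; a partition is uniform if all its blocks have the same size, and non-uniform otherwise. A primitive permutation group $G$ on $X$ is almost synchronizing if for every map $t:X\to X$ with non-uniform kernel the semigroup $\langle G,t\rangle$ contains a constant map. In (a), the projective space is the one whose points and lines are the $1$- and $2$-dimensional subspaces of an $n$-dimensional vector space over $\mathrm{GF}(q)$; $G$ is regarded as a permutation group on the set of lines. In (b), $G$ is the group of permutations $x\mapsto ax+b$ of $\mathrm{GF}(p^2)$ with $b\in\mathrm{GF}(p^2)$ and $a$ a nonzero square. In (c), the points of $W(q)$ are all the points of the $3$-dimensional projective space over $\mathrm{GF}(q)$ (the $1$-dimensional subspaces of $\mathrm{GF}(q)^4$), and its lines are the lines of this projective space that are totally isotropic with respect to a fixed nondegenerate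 symplectic form; $G$ is regarded as a permutation group on the points. *)

theory Defs
  imports "HOL-Analysis.Cartesian_Space" "HOL-Analysis.Determinants" "HOL-Algebra.Bij"
    "HOL-Algebra.Generated_Groups" "HOL-Library.Disjoint_Sets" "HOL-Library.Numeral_Type"
    "HOL-Computational_Algebra.Primes"
begin

text \<open>
  A permutation group on \<open>X\<close> is a subgroup of \<^term>\<open>BijGroup X\<close>. Following the convention of
  \<^theory>\<open>HOL-Algebra.Bij\<close>, maps \<open>X \<rightarrow> X\<close> are extensional (they take the value \<open>undefined\<close> outside
  \<open>X\<close>) and are composed with \<^const>\<open>compose\<close>.
\<close>

definition primitive_perm_group :: "'a set \<Rightarrow> ('a \<Rightarrow> 'a) set \<Rightarrow> bool" where
  "primitive_perm_group X G \<longleftrightarrow>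
     finite X \<and> subgroup G (BijGroup X) \<and>
     (\<forall>x\<in>X. \<forall>y\<in>X. \<exists>g\<in>G. g x = y) \<and>
     (\<forall>P. partition_on X P \<and> (\<forall>g\<in>G. \<forall>A\<in>P. g ` A \<in> P) \<longrightarrow> P = {X} \<or> P = (\<lambda>x. {x}) ` X)"

definition kernel_partition :: "'a set \<Rightarrow> ('a \<Rightarrow> 'a) \<Rightarrow> 'a set set" where
  "kernel_partition X t = X // {(x, y). x \<in> X \<and> y \<in> X \<and> t x = t y}"

definition uniform_partition :: "'a set set \<Rightarrow> bool" where
  "uniform_partition P \<longleftrightarrow> (\<forall>A\<in>P. \<forall>B\<in>P. card A = card B)"

inductive_set semigroup_generated :: "'a set \<Rightarrow> ('a \<Rightarrow> 'a) set \<Rightarrow> ('a \<Rightarrow> 'a) set"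
  for X :: "'a set" and S :: "('a \<Rightarrow> 'a) set" where
  incl: "f \<in> S \<Longrightarrow> f \<in> semigroup_generated X S"
| comp: "f \<in> semigroup_generated X S \<Longrightarrow> g \<in> semigroup_generated X S \<Longrightarrow>
           compose X f g \<in> semigroup_generated X S"

definition almost_synchronizing :: "'a set \<Rightarrow> ('a \<Rightarrow> 'a) set \<Rightarrow> bool" where
  "almost_synchronizing X G \<longleftrightarrow>
     primitive_perm_group X G \<and>
     (\<forall>t \<in> X \<rightarrow>\<^sub>E X. \<not> uniform_partition (kernel_partition X t) \<longrightarrow>
        (\<exists>c\<in>X. (\<lambda>x\<in>X. c) \<in> semigroup_generated X (insert t G)))"

definition subspaces :: "('k::field ^ 'n::finite) set set" where
  "subspaces = {U. vec.subspace U}"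

definition proj_points :: "('k::field ^ 'n::finite) set set" where
  "proj_points = {U. vec.subspace U \<and> vec.dim U = 1}"

definition proj_lines :: "('k::field ^ 'n::finite) set set" where
  "proj_lines = {U. vec.subspace U \<and> vec.dim U = 2}"

definition field_automorphism :: "('k::field \<Rightarrow> 'k) \<Rightarrow> bool" where
  "field_automorphism \<sigma> \<longleftrightarrow>
     bij \<sigma> \<and> (\<forall>a b. \<sigma> (a + b) = \<sigma> a + \<sigma> b) \<and> (\<forall>a b. \<sigma> (a * b) = \<sigma> a * \<sigma> b) \<and> \<sigma> 1 = 1"

definition semilinear :: "('k::field \<Rightarrow> 'k) \<Rightarrow> ('k ^ 'n::finite \<Rightarrow> 'k ^ 'n) \<Rightarrow> bool" where
  "semilinear \<sigma> f \<longleftrightarrow>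
     (\<forall>x y. f (x + y) = f x + f y) \<and> (\<forall>a x. f (a *s x) = \<sigma> a *s f x)"

definition GammaL :: "('k::field ^ 'n::finite \<Rightarrow> 'k ^ 'n) set" where
  "GammaL = {f. bij f \<and> (\<exists>\<sigma>. field_automorphism \<sigma> \<and> semilinear \<sigma> f)}"

definition SL :: "('k::field ^ 'n::finite \<Rightarrow> 'k ^ 'n) set" where
  "SL = {f. \<exists>A :: 'k ^ 'n ^ 'n. det A = 1 \<and> f = (\<lambda>x. A *v x)}"

text \<open>
  The permutation of the projective space (the set of all subspaces) induced by a semilinear
  bijection. In dimension at least 2 the semilinear bijections fixing every subspace are exactly
  the nonzero scalars, so the images below are the usual quotients by scalars.
\<close>

definition proj_map :: "('k::field ^ 'n::finite \<Rightarrow> 'k ^ 'n) \<Rightarrow> ('k ^ 'n) set \<Rightarrow> ('k ^ 'n) set" where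
  "proj_map f = (\<lambda>U\<in>subspaces. f ` U)"

definition PGammaL :: "(('k::field ^ 'n::finite) set \<Rightarrow> ('k ^ 'n) set) set" where
  "PGammaL = proj_map ` GammaL"

definition PSL :: "(('k::field ^ 'n::finite) set \<Rightarrow> ('k ^ 'n) set) set" where
  "PSL = proj_map ` SL"

definition action_on :: "'a set \<Rightarrow> ('a \<Rightarrow> 'a) set \<Rightarrow> ('a \<Rightarrow> 'a) set" where
  "action_on X G = (\<lambda>g. restrict g X) ` G"

definition affine_square_group :: "('k::field \<Rightarrow> 'k) set" where
  "affine_square_group = {(\<lambda>x. a * x + b) | a b. \<exists>c. c \<noteq> 0 \<and> a = c\<^sup>2}"

text \<open>Since the characteristic may be 2, symplectic forms are required to be alternating.\<close>

definition symplectic_form :: "('k::field ^ 'n::finite \<Rightarrow> 'k ^ 'n \<Rightarrow> 'k) \<Rightarrow> bool" where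
  "symplectic_form B \<longleftrightarrow>
     (\<forall>x. Vector_Spaces.linear (*s) (*) (B x)) \<and>
     (\<forall>y. Vector_Spaces.linear (*s) (*) (\<lambda>x. B x y)) \<and>
     (\<forall>x. B x x = 0) \<and>
     (\<forall>x. (\<forall>y. B x y = 0) \<longrightarrow> x = 0)"

definition Sp :: "('k::field ^ 'n::finite \<Rightarrow> 'k ^ 'n \<Rightarrow> 'k) \<Rightarrow> ('k ^ 'n \<Rightarrow> 'k ^ 'n) set" where
  "Sp B = {f. bij f \<and> Vector_Spaces.linear (*s) (*s) f \<and> (\<forall>x y. B (f x) (f y) = B x y)}"

definition PSp :: "('k::field ^ 'n::finite \<Rightarrow> 'k ^ 'n \<Rightarrow> 'k) \<Rightarrow>
    (('k ^ 'n) set \<Rightarrow> ('k ^ 'n) set) set" where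
  "PSp B = proj_map ` Sp B"

text \<open>
  Field automorphisms act on coordinates with respect to a symplectic basis. By nondegeneracy of
  the Gram matrix, four vectors of \<open>k\<^sup>4\<close> as below do form a basis.
\<close>

definition symplectic_basis4 ::
    "('k::field ^ 4 \<Rightarrow> 'k ^ 4 \<Rightarrow> 'k) \<Rightarrow> 'k ^ 4 \<Rightarrow> 'k ^ 4 \<Rightarrow> 'k ^ 4 \<Rightarrow> 'k ^ 4 \<Rightarrow> bool" where
  "symplectic_basis4 B e1 e2 f1 f2 \<longleftrightarrow>
     B e1 f1 = 1 \<and> B e2 f2 = 1 \<and>
     B e1 e2 = 0 \<and> B e1 f2 = 0 \<and> B e2 f1 = 0 \<and> B f1 f2 = 0"

text \<open>
  The map applying \<open>\<sigma>\<close> to the coordinates with respect to a basis is the unique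
  \<open>\<sigma>\<close>-semilinear map fixing every basis vector.
\<close>

definition field_aut_maps :: "('k::field ^ 'n::finite) set \<Rightarrow> ('k \<Rightarrow> 'k) set \<Rightarrow>
    ('k ^ 'n \<Rightarrow> 'k ^ 'n) set" where
  "field_aut_maps E S = {f. \<exists>\<sigma>\<in>S. semilinear \<sigma> f \<and> (\<forall>e\<in>E. f e = e)}"

text \<open>
  The group obtained from \<^term>\<open>PSp B\<close> by adjoining the field automorphisms in \<open>S\<close>, acting on
  coordinates with respect to the basis \<open>E\<close>; for \<open>S = {}\<close> it is \<^term>\<open>PSp B\<close> itself.
\<close>

definition PSp_adjoin :: "('k::field ^ 'n::finite \<Rightarrow> 'k ^ 'n \<Rightarrow> 'k) \<Rightarrow> ('k ^ 'n) set \<Rightarrow>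
    ('k \<Rightarrow> 'k) set \<Rightarrow> (('k ^ 'n) set \<Rightarrow> ('k ^ 'n) set) set" where
  "PSp_adjoin B E S = generate (BijGroup subspaces) (PSp B \<union> proj_map ` field_aut_maps E S)"

end

theory Submission imports Defs begin

text \<open>
  Each of the three groups is transitive with exactly two further orbits on ordered pairs, both
  symmetric, so its only nontrivial invariant graphs are a primitive strongly regular graph and its
  complement. If the semigroup generated by the group and \<open>t\<close> contains no constant map, then \<open>t\<close>
  preserves one of the invariant graphs, namely the graph of pairs that no element of the semigroup
  collapses. By an argument of Roberson, an endomorphism of a primitive strongly regular graph is
  injective or maps onto a clique, and in both cases its kernel is uniform.
\<close>

section \<open>Endomorphisms of strongly regular graphs\<close>

text \<open>The map \<open>t\<close> is only known to send edges to edges; where non-edges go is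
  unknown. The spectral step copes with this because \<open>A - \<tau> I\<close> vanishes on
  non-edges, so its trace against a pulled back Gram matrix can be computed without that
  information. Primitivity enters as two strict inequalities. If \<open>m = k\<close>, non-adjacent
  vertices share all their neighbours and the graph is complete multipartite; if
  \<open>l + 1 = k\<close>, it is a disjoint union of cliques. Such graphs have to be excluded: one
  part can be collapsed, or one clique moved onto another, while everything else stays fixed, and
  the resulting kernel can be non-uniform. That some invariant graph is preserved comes from an
  element of minimal rank: two points of its image can never be collapsed later.\<close>

locale primitive_srg =
  fixes V :: "'a set" and R :: "'a \<Rightarrow> 'a \<Rightarrow> bool" and k l m :: nat
  assumes finite_V: "finite V"
    and sym: "\<lbrakk>x \<in> V; y \<in> V; R x y\<rbrakk> \<Longrightarrow> R y x"
    and irrefl: "x \<in> V \<Longrightarrow> \<not> R x x"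
    and degree: "x \<in> V \<Longrightarrow> card {z \<in> V. R x z} = k"
    and adj: "\<lbrakk>x \<in> V; y \<in> V; R x y\<rbrakk> \<Longrightarrow> card {z \<in> V. R x z \<and> R y z} = l"
    and nonadj: "\<lbrakk>x \<in> V; y \<in> V; x \<noteq> y; \<not> R x y\<rbrakk> \<Longrightarrow> card {z \<in> V. R x z \<and> R y z} = m"
    and m_less_k: "m < k"
    and l_less_k: "l + 1 < k"
begin

section \<open>The adjacency algebra of a strongly regular graph\<close>

definition A :: "'a \<Rightarrow> 'a \<Rightarrow> real" where "A x y = of_bool (R x y)"

definition D :: "'a \<Rightarrow> 'a \<Rightarrow> real" where "D x y = of_bool (x = y)"

definition n :: real where "n = real (card V)"

lemma A_sym: "x \<in> V \<Longrightarrow> y \<in> V \<Longrightarrow> A x y = A y x"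
  using sym by (auto simp: A_def)

lemma D_sym: "D x y = D y x"
  by (auto simp: D_def)

lemma sum_D: "x \<in> V \<Longrightarrow> (\<Sum>z\<in>V. D x z * f z) = f x"
  using finite_V by (simp add: D_def of_bool_def if_distrib[of "\<lambda>c. c * _"] cong: if_cong)

lemma sum_A: "x \<in> V \<Longrightarrow> (\<Sum>z\<in>V. A x z) = k"
  using finite_V degree[of x] by (simp add: A_def Int_def)

lemma sum_AA:
  assumes "x \<in> V" "y \<in> V"
  shows "(\<Sum>z\<in>V. A x z * A z y) = k * D x y + l * A x y + m * (1 - D x y - A x y)"
proof -
  have "(\<Sum>z\<in>V. A x z * A z y) = (\<Sum>z\<in>V. of_bool (R x z \<and> R y z))"
    using sym assms by (intro sum.cong) (auto simp: A_def)
  also have "\<dots> = card {z \<in> V. R x z \<and> R y z}"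
    using finite_V by (simp add: Int_def)
  also have "\<dots> = k * D x y + l * A x y + m * (1 - D x y - A x y)"
    using assms degree[of x] adj[of x y] nonadj[of x y] irrefl[of x]
    by (cases "x = y"; cases "R x y") (auto simp: D_def A_def)
  finally show ?thesis .
qed

lemma n_pos: "x \<in> V \<Longrightarrow> n > 0"
  using finite_V by (auto simp: n_def card_gt_0_iff)

text \<open>Both sides count the edges between the neighbours of \<open>x\<close> and its
  non-neighbours other than \<open>x\<close>. The proof obtains this from the number of walks of
  length two that start at \<open>x\<close>.\<close>

lemma count:
  assumes "x \<in> V"
  shows "real k * (real k - 1 - l) = m * (n - k - 1)"
proof -
  have "(\<Sum>y\<in>V. \<Sum>z\<in>V. A x z * A z y) = (\<Sum>z\<in>V. A x z * (\<Sum>y\<in>V. A z y))"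
    by (subst sum.swap) (simp add: sum_distrib_left)
  also have "\<dots> = real k * k"
    using assms by (simp add: sum_A flip: sum_distrib_right)
  finally have 1: "(\<Sum>y\<in>V. \<Sum>z\<in>V. A x z * A z y) = real k * k" .
  have "(\<Sum>y\<in>V. \<Sum>z\<in>V. A x z * A z y) = (\<Sum>y\<in>V. k * D x y + l * A x y + m * (1 - D x y - A x y))"
    using assms by (intro sum.cong) (auto simp: sum_AA)
  also have "\<dots> = k + l * k + m * (n - 1 - k)"
    using sum_D[OF assms, of "\<lambda>_. 1"] sum_A[OF assms]
    by (simp add: sum.distrib sum_subtractf n_def flip: sum_distrib_left)
  finally show ?thesis using 1 by (simp add: algebra_simps)
qed

text \<open>
  If \<open>r\<close> and \<open>s\<close> are the two eigenvalues of \<open>A\<close> other than \<open>k\<close>, then \<open>E r\<close> is \<open>r - s\<close> times the orthogonal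
  projection onto the \<open>s\<close>-eigenspace.
\<close>

definition E :: "real \<Rightarrow> 'a \<Rightarrow> 'a \<Rightarrow> real" where
  "E r x y = r * D x y - A x y + (real k - r) / n"

lemma E_sym: "x \<in> V \<Longrightarrow> y \<in> V \<Longrightarrow> E r x y = E r y x"
  by (simp add: E_def A_sym D_sym)

text \<open>The polynomial with roots \<open>r\<close> and \<open>s\<close>, evaluated at
  \<open>A\<close>, is \<open>m\<close> times the all-ones matrix. Applied to the all-ones vector,
  an eigenvector of \<open>A\<close> for \<open>k\<close>, this compares
  \<open>(k - r) (k - s)\<close> with \<open>m n\<close>.\<close>

lemma n_roots:
  assumes "x \<in> V" "r + s = real l - m" "r * s = real m - k"
  shows "m * n = (real k - r) * (real k - s)"
proof -
  have "(real k - r) * (real k - s) = real k * k - k * (r + s) + r * s"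
    by (simp add: algebra_simps)
  then show ?thesis
    using count[OF assms(1)] unfolding assms by (simp add: algebra_simps)
qed

lemma sum_EE:
  assumes "x \<in> V" "y \<in> V" and r: "r + s = real l - m" "r * s = real m - k"
  shows "(\<Sum>z\<in>V. E r x z * E r z y) = (r - s) * E r x y"
proof -
  define c where "c = (real k - r) / n"
  have n: "n > 0" using assms n_pos by blast
  have cn: "c * n = k - r" using n by (simp add: c_def)
  have "c * (r - s) * n = (c * n) * (r - s)"
    by (simp add: algebra_simps)
  also have "\<dots> = m * n - (real k - r) * (real k - r)"
    unfolding cn using n_roots[OF assms(1) r] by (simp add: algebra_simps)
  also have "\<dots> = (m - c * (real k - r)) * n"
    unfolding cn[symmetric] by (simp add: algebra_simps)
  \<comment> \<open>With \<open>c n = k - r\<close>, this identifies the coefficient of the all-ones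
    matrix in the square of \<open>E r\<close> with \<open>c (r - s)\<close>.\<close>
  finally have c2: "m - c * (real k - r) = c * (r - s)" using n by simp
  have "(\<Sum>z\<in>V. E r x z * E r z y) =
     (\<Sum>z\<in>V. r * (D x z * (r * D z y)) - r * (D x z * A z y) + c * r * D x z
        - r * (D y z * A x z) + A x z * A z y - c * A x z
        + c * r * D y z - c * A y z + c * c)"
    using assms(1,2) by (intro sum.cong) (auto simp: E_def c_def[symmetric] algebra_simps D_sym[of _ y] A_sym[of _ y])
  also have "\<dots> = r * r * D x y - r * A x y + c * r - r * A x y
        + (k * D x y + l * A x y + m * (1 - D x y - A x y)) - c * k + c * r - c * k + c * c * n"
    using assms(1,2) sum_D[of x "\<lambda>_. 1"] sum_D[of y "\<lambda>_. 1"]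
    by (simp add: sum.distrib sum_subtractf sum_D sum_A sum_AA n_def flip: sum_distrib_left)
  also have "\<dots> = (r * r + k - m) * D x y + (real l - m - 2 * r) * A x y + (m - c * (real k - r)) + c * (c * n - (real k - r))"
    by (simp add: algebra_simps)
  also have "\<dots> = (r - s) * E r x y"
    unfolding c2 cn unfolding E_def r(1)[symmetric] c_def[symmetric]
    using arg_cong[OF r(2), of "\<lambda>t. t * D x y"] by (simp add: algebra_simps)
  finally show ?thesis .
qed

section \<open>The two restricted eigenvalues and the resulting quadratic forms\<close>

definition \<theta> :: real where
  "\<theta> = ((real l - m) + sqrt ((real l - m)\<^sup>2 + 4 * (real k - m))) / 2"

definition \<tau> :: real where
  "\<tau> = ((real l - m) - sqrt ((real l - m)\<^sup>2 + 4 * (real k - m))) / 2"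

text \<open>These are Vieta's formulas for \<open>t^2 - (l - m) t - (k - m)\<close>, the polynomial
  that annihilates \<open>A\<close> on vectors with coordinate sum zero.\<close>

lemma roots: "\<theta> + \<tau> = real l - m" "\<theta> * \<tau> = real m - k"
proof -
  define d where "d = sqrt ((real l - m)\<^sup>2 + 4 * (real k - m))"
  have "d\<^sup>2 = (real l - m)\<^sup>2 + 4 * (real k - m)"
    using m_less_k by (simp add: d_def)
  moreover have "\<theta> * \<tau> = ((real l - m)\<^sup>2 - d\<^sup>2) / 4"
    unfolding \<theta>_def \<tau>_def d_def[symmetric] by (simp add: power2_eq_square algebra_simps)
  ultimately show "\<theta> * \<tau> = real m - k"
    by simp
qed (simp add: \<theta>_def \<tau>_def field_simps)

lemma theta_pos: "\<theta> > 0" and tau_neg: "\<tau> < 0"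
proof -
  have "sqrt ((real l - m)\<^sup>2 + 4 * (real k - m)) > sqrt ((real l - m)\<^sup>2)"
    using m_less_k by (intro real_sqrt_less_mono) simp
  then show "\<theta> > 0" "\<tau> < 0" by (auto simp: \<theta>_def \<tau>_def)
qed

lemma sum_quadratic:
  assumes "\<And>u v. u \<in> V \<Longrightarrow> v \<in> V \<Longrightarrow> F u v = (\<Sum>x\<in>V. G x u * G x v)"
  shows "(\<Sum>u\<in>V. \<Sum>v\<in>V. F u v * (z u * z v)) = (\<Sum>x\<in>V. (\<Sum>u\<in>V. G x u * z u)\<^sup>2 :: real)"
proof -
  have "(\<Sum>x\<in>V. (\<Sum>u\<in>V. G x u * z u)\<^sup>2) = (\<Sum>x\<in>V. \<Sum>u\<in>V. \<Sum>v\<in>V. G x u * z u * (G x v * z v))"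
    by (simp add: power2_eq_square sum_product)
  also have "\<dots> = (\<Sum>u\<in>V. \<Sum>x\<in>V. \<Sum>v\<in>V. G x u * z u * (G x v * z v))"
    by (rule sum.swap)
  also have "\<dots> = (\<Sum>u\<in>V. \<Sum>v\<in>V. \<Sum>x\<in>V. G x u * z u * (G x v * z v))"
    by (intro sum.cong sum.swap refl)
  also have "\<dots> = (\<Sum>u\<in>V. \<Sum>v\<in>V. F u v * (z u * z v))"
    by (intro sum.cong refl) (simp add: assms sum_distrib_right sum_distrib_left mult_ac)
  finally show ?thesis by simp
qed

text \<open>This is the spectral decomposition of \<open>A - \<tau> I\<close>, whose eigenvalues are
  0, \<open>\<theta> - \<tau>\<close> and \<open>k - \<tau>\<close>. Written as a sum of squares it
  shows positive semidefiniteness, and also that the form vanishes only at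
  \<open>\<tau>\<close>-eigenvectors.\<close>

lemma tau_form:
  "(\<Sum>u\<in>V. \<Sum>v\<in>V. (A u v - \<tau> * D u v) * (z u * z v)) =
     (\<Sum>x\<in>V. (\<Sum>u\<in>V. E \<tau> x u * z u)\<^sup>2) / (\<theta> - \<tau>) + (real k - \<tau>) / n * (\<Sum>u\<in>V. z u)\<^sup>2"
proof -
  define d where "d = (real k - \<tau>) / n"
  have pos: "\<theta> - \<tau> > 0" using theta_pos tau_neg by simp
  have "(\<Sum>u\<in>V. \<Sum>v\<in>V. ((\<tau> - \<theta>) * E \<tau> u v) * (z u * z v)) = (\<Sum>x\<in>V. (\<Sum>u\<in>V. E \<tau> x u * z u)\<^sup>2)"
    using roots sum_EE[of _ _ \<tau> \<theta>] by (intro sum_quadratic) (simp add: E_sym add.commute mult.commute)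
  then have "(\<Sum>x\<in>V. (\<Sum>u\<in>V. E \<tau> x u * z u)\<^sup>2) / (\<theta> - \<tau>)
      = (\<Sum>u\<in>V. \<Sum>v\<in>V. ((\<tau> - \<theta>) * E \<tau> u v) * (z u * z v)) / (\<theta> - \<tau>)" by simp
  also have "\<dots> = (\<Sum>u\<in>V. \<Sum>v\<in>V. - E \<tau> u v * (z u * z v))"
    unfolding sum_divide_distrib using pos by (intro sum.cong refl) (simp add: field_simps)
  also have "\<dots> = (\<Sum>u\<in>V. \<Sum>v\<in>V. (A u v - \<tau> * D u v) * (z u * z v) - d * (z u * z v))"
    by (intro sum.cong refl) (simp add: E_def d_def[symmetric] algebra_simps)
  also have "\<dots> = (\<Sum>u\<in>V. \<Sum>v\<in>V. (A u v - \<tau> * D u v) * (z u * z v)) - d * (\<Sum>u\<in>V. z u)\<^sup>2"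
    by (simp add: sum_subtractf power2_eq_square sum_product flip: sum_distrib_left)
  finally show ?thesis by (simp add: d_def)
qed

text \<open>
  The Gram matrix \<open>E \<theta>\<close> of the least eigenspace, pulled back along \<open>\<phi>\<close>, agrees with the original one on
  the diagonal and on edges. Hence its product with \<open>A - \<tau> I\<close> has trace zero, and since both are positive
  semidefinite that product vanishes.
\<close>

lemma hom_eigenvector:
  assumes hom: "\<phi> \<in> V \<rightarrow> V" "\<And>u v. u \<in> V \<Longrightarrow> v \<in> V \<Longrightarrow> R u v \<Longrightarrow> R (\<phi> u) (\<phi> v)"
    and u: "u \<in> V" and w: "w \<in> V"
  shows "(\<Sum>v\<in>V. A u v * E \<theta> (\<phi> v) w) = \<tau> * E \<theta> (\<phi> u) w"
proof -
  define c where "c = (real k - \<theta>) / n"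
  \<comment> \<open>\<open>Q w\<close> is the form of \<open>A - \<tau> I\<close> at the vector
    \<open>u \<mapsto> E \<theta> (\<phi> u) w\<close>. Since \<open>E \<theta>\<close> is
    idempotent up to the factor \<open>\<theta> - \<tau>\<close>, its own columns realize it as a
    Gram matrix, and summing \<open>Q w\<close> over \<open>w\<close> gives a multiple of the
    trace.\<close>
  define Q where "Q w = (\<Sum>u\<in>V. \<Sum>v\<in>V. (A u v - \<tau> * D u v) * (E \<theta> (\<phi> u) w * E \<theta> (\<phi> v) w))" for w
  have n: "n > 0" using u n_pos by blast
  have pos: "\<theta> - \<tau> > 0" "(real k - \<tau>) / n > 0"
    using theta_pos tau_neg n by (auto simp: divide_simps)
  have phi: "\<phi> v \<in> V" if "v \<in> V" for v using that hom by auto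
  \<comment> \<open>The left side is a diagonal entry of \<open>(A - \<tau> I) E \<theta>\<close>:
    there are \<open>k\<close> edges with entry \<open>c - 1\<close>, and the diagonal entry of
    \<open>E \<theta>\<close> is \<open>\<theta> + c\<close>. The product is zero because
    \<open>E \<theta>\<close> maps into the \<open>\<tau>\<close>-eigenspace.\<close>
  have zero: "k * (c - 1) - \<tau> * (\<theta> + c) = 0"
  proof -
    have cn: "c * n = real k - \<theta>" using n by (simp add: c_def)
    have "(c * (real k - \<tau>)) * n = (c * n) * (real k - \<tau>)" by simp
    also have "\<dots> = m * n" unfolding cn using n_roots[OF u roots] by simp
    finally have "c * (real k - \<tau>) = m" using n by simp
    then show ?thesis using roots(2) by (simp add: algebra_simps)
  qed
  have tm: "(A u v - \<tau> * D u v) * E \<theta> (\<phi> u) (\<phi> v) = (c - 1) * A u v - (\<tau> * (\<theta> + c)) * D u v"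
    if "u \<in> V" "v \<in> V" for u v
    using that hom(2)[OF that] irrefl[OF that(1)] irrefl[OF phi[OF that(1)]]
    by (cases "u = v"; cases "R u v") (auto simp: E_def c_def[symmetric] A_def D_def)
  have "(\<Sum>w\<in>V. Q w) = (\<Sum>w\<in>V. \<Sum>u\<in>V. \<Sum>v\<in>V. (A u v - \<tau> * D u v) * (E \<theta> (\<phi> u) w * E \<theta> (\<phi> v) w))"
    by (simp add: Q_def)
  also have "\<dots> = (\<Sum>u\<in>V. \<Sum>w\<in>V. \<Sum>v\<in>V. (A u v - \<tau> * D u v) * (E \<theta> (\<phi> u) w * E \<theta> (\<phi> v) w))"
    by (rule sum.swap)
  also have "\<dots> = (\<Sum>u\<in>V. \<Sum>v\<in>V. \<Sum>w\<in>V. (A u v - \<tau> * D u v) * (E \<theta> (\<phi> u) w * E \<theta> (\<phi> v) w))"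
    by (intro sum.cong sum.swap refl)
  also have "\<dots> = (\<Sum>u\<in>V. \<Sum>v\<in>V. (A u v - \<tau> * D u v) * ((\<theta> - \<tau>) * E \<theta> (\<phi> u) (\<phi> v)))"
    using sum_EE[OF phi phi roots] phi
    by (intro sum.cong refl) (simp add: E_sym flip: sum_distrib_left)
  also have "\<dots> = (\<Sum>u\<in>V. \<Sum>v\<in>V. (\<theta> - \<tau>) * ((c - 1) * A u v - (\<tau> * (\<theta> + c)) * D u v))"
    using tm by (intro sum.cong refl) (simp add: mult.left_commute)
  also have "\<dots> = (\<Sum>u\<in>V. (\<theta> - \<tau>) * ((c - 1) * k - \<tau> * (\<theta> + c)))"
    using sum_D[of _ "\<lambda>_. 1"] by (intro sum.cong refl) (simp add: sum_A sum_subtractf flip: sum_distrib_left)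
  also have "\<dots> = 0" using zero by (simp add: algebra_simps)
  finally have sumQ: "(\<Sum>w\<in>V. Q w) = 0" .
  define z where "z u = E \<theta> (\<phi> u) w" for u
  have Q: "Q w = (\<Sum>x\<in>V. (\<Sum>u\<in>V. E \<tau> x u * E \<theta> (\<phi> u) w)\<^sup>2) / (\<theta> - \<tau>)
      + (real k - \<tau>) / n * (\<Sum>u\<in>V. E \<theta> (\<phi> u) w)\<^sup>2" for w
    unfolding Q_def by (rule tau_form)
  have parts: "(\<Sum>x\<in>V. (\<Sum>u\<in>V. E \<tau> x u * E \<theta> (\<phi> u) w)\<^sup>2) / (\<theta> - \<tau>) \<ge> 0"
    "(real k - \<tau>) / n * (\<Sum>u\<in>V. E \<theta> (\<phi> u) w)\<^sup>2 \<ge> 0" for w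
    using pos by (simp add: sum_nonneg, intro mult_nonneg_nonneg) auto
  have "Q w \<ge> 0" for w using parts[of w] by (simp add: Q)
  then have "Q w = 0"
    using sumQ finite_V w by (simp add: sum_nonneg_eq_0_iff)
  then have "(\<Sum>x\<in>V. (\<Sum>u\<in>V. E \<tau> x u * z u)\<^sup>2) / (\<theta> - \<tau>) = 0"
    "(real k - \<tau>) / n * (\<Sum>u\<in>V. z u)\<^sup>2 = 0"
    using parts[of w] unfolding Q z_def by linarith+
  then have sumsq: "(\<Sum>x\<in>V. (\<Sum>u\<in>V. E \<tau> x u * z u)\<^sup>2) = 0" and sumz: "(\<Sum>u\<in>V. z u) = 0"
    using pos by auto
  \<comment> \<open>\<open>E \<tau>\<close> kills \<open>z\<close>; because the entries of
    \<open>z\<close> sum to zero, the constant part of \<open>E \<tau>\<close> drops out and what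
    remains is the eigenvector equation.\<close>
  have "(\<Sum>v\<in>V. E \<tau> u v * z v) = 0"
    using sumsq finite_V u by (simp add: sum_nonneg_eq_0_iff)
  moreover have "(\<Sum>v\<in>V. E \<tau> u v * z v) = \<tau> * z u - (\<Sum>v\<in>V. A u v * z v) + (real k - \<tau>) / n * (\<Sum>v\<in>V. z v)"
  proof -
    define d where "d = (real k - \<tau>) / n"
    have "(\<Sum>v\<in>V. E \<tau> u v * z v) = (\<Sum>v\<in>V. \<tau> * (D u v * z v) - A u v * z v + d * z v)"
      by (intro sum.cong refl) (simp add: E_def d_def[symmetric] algebra_simps)
    then show ?thesis unfolding d_def[symmetric]
      using sum_D[OF u, of z] by (simp add: sum.distrib sum_subtractf flip: sum_distrib_left)
  qed
  ultimately show ?thesis using sumz by (simp add: z_def)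
qed

text \<open>This is connectedness of the graph induced on the non-neighbours of \<open>u\<close>, in
  the form of an induction principle. If \<open>x\<close> and \<open>y\<close> lay in different
  components, all \<open>m\<close> common neighbours of \<open>x\<close> and \<open>y\<close> would
  be adjacent to \<open>u\<close>, so \<open>x\<close> and \<open>y\<close> would have the same
  neighbours inside the neighbourhood of \<open>u\<close>.\<close>

lemma nonneighbours_connected:
  assumes u: "u \<in> V" and v: "v \<in> V" "v \<noteq> u" "\<not> R u v" "P v"
    and w: "w \<in> V" "w \<noteq> u" "\<not> R u w"
    and closed: "\<And>x y. \<lbrakk>x \<in> V; y \<in> V; x \<noteq> u; y \<noteq> u; \<not> R u x; \<not> R u y; R x y; P x\<rbrakk> \<Longrightarrow> P y"
  shows "P w"
proof (rule ccontr)
  assume w': "\<not> P w"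
  define T where "T x = {t \<in> V. R u t \<and> R x t}" for x
  have T_eq: "T x = T y"
    if x: "x \<in> V" "x \<noteq> u" "\<not> R u x" "P x" and y: "y \<in> V" "y \<noteq> u" "\<not> R u y" "\<not> P y" for x y
  proof -
    have "x \<noteq> y" "\<not> R x y" using that closed by blast+
    then have c: "card {t \<in> V. R x t \<and> R y t} = m" using x y nonadj by auto
    have "R u t" if "t \<in> V" "R x t" "R y t" for t
    proof (rule ccontr)
      assume "\<not> R u t"
      moreover have "t \<noteq> u" using that sym u x by blast
      ultimately show False
        using that closed[of x t] closed[of t y] x y u sym by blast
    qed
    then have "{t \<in> V. R x t \<and> R y t} \<subseteq> T x" "{t \<in> V. R x t \<and> R y t} \<subseteq> T y"
      by (auto simp: T_def)
    moreover have "card (T x) = m" "card (T y) = m"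
      unfolding T_def using x y u nonadj by auto
    moreover have "finite (T x)" "finite (T y)" using finite_V by (auto simp: T_def)
    ultimately show ?thesis using c card_subset_eq by metis
  qed
  have T_const: "T x = T v" if "x \<in> V" "x \<noteq> u" "\<not> R u x" for x
    using that v w w' T_eq[of x w] T_eq[of v w] T_eq[of v x] by metis
  \<comment> \<open>All non-neighbours of \<open>u\<close> now attach to the same \<open>m\<close>
    neighbours of \<open>u\<close>. As \<open>m < k\<close>, some neighbour \<open>s\<close> of
    \<open>u\<close> attaches to none of them, so its only neighbours are \<open>u\<close> and the
    \<open>l\<close> common ones.\<close>
  have "card (T v) < card {t \<in> V. R u t}"
    unfolding T_def using u v nonadj degree m_less_k by auto
  then have "\<not> {t \<in> V. R u t} \<subseteq> T v"
    using card_mono[of "T v" "{t \<in> V. R u t}"] finite_V by (auto simp: T_def not_le)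
  then obtain s where s: "s \<in> V" "R u s" "s \<notin> T v" by auto
  have "{t \<in> V. R s t} = insert u {t \<in> V. R u t \<and> R s t}"
    using s u sym T_const by (auto simp: T_def)
  moreover have "u \<notin> {t \<in> V. R u t \<and> R s t}" using u irrefl by auto
  ultimately have "k = Suc l"
    using degree[OF s(1)] adj[OF u s(1,2)] finite_V by simp
  then show False using l_less_k by simp
qed

text \<open>Otherwise \<open>v\<close> is adjacent to every non-neighbour of \<open>u\<close>, which
  forces \<open>N\<close> to have \<open>k - 1 - l\<close> elements; then \<open>count\<close>
  leaves only \<open>k = m\<close> or \<open>k = l + 1\<close>. The lemma provides chains of length
  two in the complement.\<close>

lemma common_nonneighbour:
  assumes u: "u \<in> V" and v: "v \<in> V" and uv: "R u v"
  obtains w where "w \<in> V" "w \<noteq> u" "w \<noteq> v" "\<not> R u w" "\<not> R v w"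
proof (rule ccontr)
  assume "\<not> thesis"
  then have all: "w \<in> V \<Longrightarrow> w \<noteq> u \<Longrightarrow> w \<noteq> v \<Longrightarrow> R u w \<or> R v w" for w using that by blast
  define N where "N = {w \<in> V. w \<noteq> u \<and> \<not> R u w}"
  have "V = insert u ({w \<in> V. R u w} \<union> N)" using u by (auto simp: N_def)
  moreover have "card \<dots> = Suc (k + card N)"
    using finite_V irrefl u degree[OF u] by (subst card_insert_disjoint) (auto simp: N_def card_Un_disjoint disjoint_iff)
  ultimately have cN: "n = k + card N + 1" by (simp add: n_def)
  have "{w \<in> V. R v w} = insert u ({w \<in> V. R u w \<and> R v w} \<union> N)"
    using all u v uv sym irrefl by (auto simp: N_def)
  moreover have "card \<dots> = Suc (l + card N)"
    using finite_V irrefl u adj[OF u v uv] by (subst card_insert_disjoint) (auto simp: N_def card_Un_disjoint disjoint_iff)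
  ultimately have "real k = l + card N + 1" using degree[OF v] by simp
  then have "(real k - m) * (real k - 1 - l) = 0"
    using count[OF u] cN by (simp add: algebra_simps)
  then show False using m_less_k l_less_k by auto
qed

text \<open>
  The difference of the \<open>u\<close>-columns of the pulled back Gram matrix and the original one is a
  \<open>\<tau>\<close>-eigenvector that vanishes on \<open>u\<close> and its neighbours. The eigenvector equation shows that its
  support is closed under adjacency among the non-neighbours of \<open>u\<close>, so it is all of them or empty.
\<close>

theorem hom_injective_or_clique:
  assumes hom: "\<phi> \<in> V \<rightarrow> V" "\<And>u v. u \<in> V \<Longrightarrow> v \<in> V \<Longrightarrow> R u v \<Longrightarrow> R (\<phi> u) (\<phi> v)"
  shows "inj_on \<phi> V \<or> (\<forall>u\<in>V. \<forall>v\<in>V. \<phi> u = \<phi> v \<or> R (\<phi> u) (\<phi> v))"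
proof -
  define P where "P u v \<longleftrightarrow> \<phi> u = \<phi> v \<or> R (\<phi> u) (\<phi> v)" for u v
  have phi: "\<phi> v \<in> V" if "v \<in> V" for v using that hom by auto
  have P_sym: "P u v \<Longrightarrow> P v u" if "u \<in> V" "v \<in> V" for u v
    using that phi sym by (auto simp: P_def)
  have P_closed: "P u y"
    if u: "u \<in> V" and x: "x \<in> V" "x \<noteq> u" "\<not> R u x" "P u x" and y: "y \<in> V" "y \<noteq> u" "\<not> R u y" and xy: "R x y"
    for u x y
  proof (rule ccontr)
    assume not: "\<not> P u y"
    define f where "f v = E \<theta> (\<phi> v) (\<phi> u) - E \<theta> v u" for v
    have "(\<Sum>v\<in>V. A y v * f v) = \<tau> * f y"
      using hom_eigenvector[OF hom y(1) phi[OF u]] hom_eigenvector[of "\<lambda>x. x", OF _ _ y(1) u]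
      by (simp add: f_def right_diff_distrib sum_subtractf)
    moreover have "f y = 0"
    proof -
      have "\<not> R (\<phi> y) (\<phi> u)" "\<phi> y \<noteq> \<phi> u" "\<not> R y u"
        using not y u sym phi unfolding P_def by metis+
      then show ?thesis using y by (simp add: f_def E_def D_def A_def)
    qed
    ultimately have sum0: "(\<Sum>v\<in>V. A y v * f v) = 0" by simp
    \<comment> \<open>For a neighbour \<open>v\<close> of \<open>y\<close>,
      \<open>\<phi> v = \<phi> u\<close> would make \<open>\<phi> y\<close> adjacent to
      \<open>\<phi> u\<close>, against \<open>not\<close>. So \<open>f v\<close> is -1 if the
      non-adjacent pair \<open>v\<close>, \<open>u\<close> becomes adjacent, and 0 otherwise. All
      terms have one sign, and the term of \<open>x\<close> is negative.\<close>
    have nonpos: "A y v * f v \<le> 0" if v: "v \<in> V" for v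
    proof (cases "R y v")
      case True
      then have "\<phi> v \<noteq> \<phi> u"
        using not True y v u hom(2) sym phi unfolding P_def by metis
      moreover have "v \<noteq> u" using True y u sym by blast
      moreover have "R v u \<Longrightarrow> R (\<phi> v) (\<phi> u)" using v u hom by blast
      ultimately show ?thesis by (auto simp: f_def E_def D_def A_def)
    qed (simp add: A_def)
    have yx: "R y x" using xy x y sym by blast
    have "\<phi> x \<noteq> \<phi> u"
      using not yx y x u hom(2) sym phi unfolding P_def by metis
    then have "R (\<phi> x) (\<phi> u)" "\<not> R x u"
      using x u sym phi unfolding P_def by metis+
    then have "A y x * f x < 0"
      using yx \<open>\<phi> x \<noteq> \<phi> u\<close> x by (simp add: f_def E_def D_def A_def)
    then have "(\<Sum>v\<in>V. A y v * f v) < 0"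
      using nonpos sum_strict_mono_ex1[of V "\<lambda>v. A y v * f v" "\<lambda>_. 0"] finite_V x by auto
    then show False using sum0 by simp
  qed
  have P_all: "P u w"
    if "u \<in> V" "v \<in> V" "v \<noteq> u" "\<not> R u v" "P u v" "w \<in> V" "w \<noteq> u" "\<not> R u w" for u v w
    using that P_closed[of u] by (intro nonneighbours_connected[of u v "P u" w]) blast+
  show ?thesis
  proof (cases "\<exists>u\<in>V. \<exists>v\<in>V. v \<noteq> u \<and> \<not> R u v \<and> P u v")
    case True
    then obtain u v where uv: "u \<in> V" "v \<in> V" "v \<noteq> u" "\<not> R u v" "P u v" by blast
    \<comment> \<open>If one non-neighbour of \<open>x\<close> satisfies \<open>P x\<close>, then
      all do, among them \<open>y\<close>; by symmetry \<open>x\<close> is then such a non-neighbour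
      of \<open>y\<close>. The property thus travels along non-adjacent pairs, and two steps reach
      every vertex.\<close>
    have step: "\<exists>z\<in>V. z \<noteq> y \<and> \<not> R y z \<and> P y z"
      if "x \<in> V" "y \<in> V" "x \<noteq> y" "\<not> R x y" "\<exists>z\<in>V. z \<noteq> x \<and> \<not> R x z \<and> P x z" for x y
      using that P_all[of x _ y] P_sym[of x y] sym by blast
    have nonadj_P: "\<exists>z\<in>V. z \<noteq> y \<and> \<not> R y z \<and> P y z" if y: "y \<in> V" for y
    proof (cases "R u y")
      case True
      then obtain w where "w \<in> V" "w \<noteq> u" "w \<noteq> y" "\<not> R u w" "\<not> R y w"
        using common_nonneighbour uv(1) y by blast
      then show ?thesis using step[of u w] step[of w y] uv y sym by blast
    next
      case False
      then show ?thesis using step[of u y] uv y by blast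
    qed
    have "\<phi> x = \<phi> y \<or> R (\<phi> x) (\<phi> y)" if "x \<in> V" "y \<in> V" for x y
      using nonadj_P[OF that(1)] P_all[of x _ y] hom(2)[of x y] that by (auto simp: P_def)
    then show ?thesis by blast
  next
    case False
    have "inj_on \<phi> V"
      using False hom(2) irrefl phi unfolding inj_on_def P_def by metis
    then show ?thesis ..
  qed
qed

end

section \<open>Groups of rank 3\<close>

text \<open>The two path assumptions say that neither relation becomes an equivalence when equality
  is added. With only two nontrivial orbits on pairs this is primitivity, in a form that can be
  checked by exhibiting three points.\<close>

locale rank3_group =
  fixes X :: "'a set" and G :: "('a \<Rightarrow> 'a) set" and R :: "'a \<Rightarrow> 'a \<Rightarrow> bool"
  assumes finite_X: "finite X"
    and subgroup: "subgroup G (BijGroup X)"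
    and R_sym: "\<lbrakk>x \<in> X; y \<in> X; R x y\<rbrakk> \<Longrightarrow> R y x"
    and R_irrefl: "x \<in> X \<Longrightarrow> \<not> R x x"
    and R_invariant: "\<lbrakk>g \<in> G; x \<in> X; y \<in> X\<rbrakk> \<Longrightarrow> R (g x) (g y) \<longleftrightarrow> R x y"
    and transitive: "\<lbrakk>x \<in> X; y \<in> X\<rbrakk> \<Longrightarrow> \<exists>g\<in>G. g x = y"
    and transitive_R: "\<lbrakk>x \<in> X; y \<in> X; u \<in> X; v \<in> X; R x y; R u v\<rbrakk> \<Longrightarrow> \<exists>g\<in>G. g x = u \<and> g y = v"
    and transitive_not_R: "\<lbrakk>x \<in> X; y \<in> X; u \<in> X; v \<in> X; x \<noteq> y; \<not> R x y; u \<noteq> v; \<not> R u v\<rbrakk>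
          \<Longrightarrow> \<exists>g\<in>G. g x = u \<and> g y = v"
    and path_R: "\<exists>a\<in>X. \<exists>b\<in>X. \<exists>c\<in>X. R a b \<and> R b c \<and> a \<noteq> c \<and> \<not> R a c"
    and path_not_R: "\<exists>a\<in>X. \<exists>b\<in>X. \<exists>c\<in>X. a \<noteq> b \<and> b \<noteq> c \<and> \<not> R a b \<and> \<not> R b c \<and> R a c"
begin

lemma G_bij: "g \<in> G \<Longrightarrow> bij_betw g X X"
  using subgroup.subset[OF subgroup] by (auto simp: BijGroup_def Bij_def)

lemma G_closed: "g \<in> G \<Longrightarrow> x \<in> X \<Longrightarrow> g x \<in> X"
  using G_bij bij_betwE by blast

lemma G_eq_iff: "g \<in> G \<Longrightarrow> x \<in> X \<Longrightarrow> y \<in> X \<Longrightarrow> g x = g y \<longleftrightarrow> x = y"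
  using G_bij bij_betw_imp_inj_on inj_on_eq_iff by metis

lemma G_funcset: "g \<in> G \<Longrightarrow> g \<in> X \<rightarrow>\<^sub>E X"
  using subgroup.subset[OF subgroup] by (auto simp: BijGroup_def Bij_def PiE_def bij_betw_def)

text \<open>A pair that is never collapsed may belong to either orbit, so the theory must be
  available for both graphs; exchanging them exchanges the two path assumptions.\<close>

lemma complement: "rank3_group X G (\<lambda>x y. x \<noteq> y \<and> \<not> R x y)"
proof (rule rank3_group.intro[OF finite_X subgroup])
  show "\<exists>a\<in>X. \<exists>b\<in>X. \<exists>c\<in>X. (a \<noteq> b \<and> \<not> R a b) \<and> (b \<noteq> c \<and> \<not> R b c) \<and> a \<noteq> c \<and> \<not> (a \<noteq> c \<and> \<not> R a c)"
    using path_not_R R_irrefl by blast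
  show "\<exists>a\<in>X. \<exists>b\<in>X. \<exists>c\<in>X. a \<noteq> b \<and> b \<noteq> c \<and> \<not> (a \<noteq> b \<and> \<not> R a b) \<and> \<not> (b \<noteq> c \<and> \<not> R b c) \<and> a \<noteq> c \<and> \<not> R a c"
    using path_R R_irrefl by metis
next
  fix x y u v assume "x \<in> X" "y \<in> X" "u \<in> X" "v \<in> X" "x \<noteq> y" "\<not> (x \<noteq> y \<and> \<not> R x y)" "u \<noteq> v" "\<not> (u \<noteq> v \<and> \<not> R u v)"
  then show "\<exists>g\<in>G. g x = u \<and> g y = v" using transitive_R[of x y u v] by blast
next
  fix x y u v assume "x \<in> X" "y \<in> X" "u \<in> X" "v \<in> X" "x \<noteq> y \<and> \<not> R x y" "u \<noteq> v \<and> \<not> R u v"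
  then show "\<exists>g\<in>G. g x = u \<and> g y = v" using transitive_not_R[of x y u v] by blast
next
  fix x y assume "x \<in> X" "y \<in> X" "x \<noteq> y \<and> \<not> R x y"
  then show "y \<noteq> x \<and> \<not> R y x" using R_sym by blast
qed (use transitive R_invariant G_eq_iff in auto)

section \<open>Regularity parameters and primitivity\<close>

lemma card_common_neighbours:
  assumes "g \<in> G" "x \<in> X" "y \<in> X"
  shows "card {z \<in> X. R (g x) z \<and> R (g y) z} = card {z \<in> X. R x z \<and> R y z}"
proof -
  have "{z \<in> X. R (g x) z \<and> R (g y) z} = g ` {z \<in> X. R x z \<and> R y z}"
  proof (intro equalityI subsetI)
    fix z assume z: "z \<in> {z \<in> X. R (g x) z \<and> R (g y) z}"
    then obtain w where "w \<in> X" "z = g w"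
      using bij_betw_imp_surj_on[OF G_bij[OF assms(1)]] by blast
    then show "z \<in> g ` {z \<in> X. R x z \<and> R y z}"
      using z R_invariant[OF assms(1)] assms(2,3) by auto
  next
    fix z assume "z \<in> g ` {z \<in> X. R x z \<and> R y z}"
    then show "z \<in> {z \<in> X. R (g x) z \<and> R (g y) z}"
      using R_invariant[OF assms(1)] G_closed[OF assms(1)] assms(2,3) by auto
  qed
  moreover have "inj_on g {z \<in> X. R x z \<and> R y z}"
    using bij_betw_imp_inj_on[OF G_bij[OF assms(1)]] by (rule inj_on_subset) auto
  ultimately show ?thesis by (simp add: card_image)
qed

text \<open>Transitivity on each kind of pair makes the counts constant. In the path
  \<open>a\<close>, \<open>b\<close>, \<open>c\<close>, both ends are neighbours of \<open>b\<close>
  that are not common neighbours of \<open>a\<close> and \<open>b\<close>, so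
  \<open>l + 2 \<le> k\<close>. In the complementary path, \<open>c'\<close> is a neighbour of
  \<open>a'\<close> but not of \<open>b'\<close>, so \<open>m < k\<close>.\<close>

lemma strongly_regular: "\<exists>k l m. primitive_srg X R k l m"
proof -
  obtain a b c where R: "a \<in> X" "b \<in> X" "c \<in> X" "R a b" "R b c" "a \<noteq> c" "\<not> R a c"
    using path_R by blast
  obtain a' b' c' where N: "a' \<in> X" "b' \<in> X" "c' \<in> X" "a' \<noteq> b'" "b' \<noteq> c'" "\<not> R a' b'" "\<not> R b' c'" "R a' c'"
    using path_not_R by blast
  define k where "k = card {z \<in> X. R a z}"
  define l where "l = card {z \<in> X. R a z \<and> R b z}"
  define m where "m = card {z \<in> X. R a' z \<and> R b' z}"
  have degree: "card {z \<in> X. R x z} = k" if x: "x \<in> X" for x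
  proof -
    obtain g where "g \<in> G" "g a = x" using transitive R x by blast
    then show ?thesis using card_common_neighbours[of g a a] R by (simp add: k_def)
  qed
  have "insert a (insert c {z \<in> X. R a z \<and> R b z}) \<subseteq> {z \<in> X. R b z}"
    using R R_sym[of a b] by auto
  then have "card (insert a (insert c {z \<in> X. R a z \<and> R b z})) \<le> k"
    unfolding degree[OF R(2), symmetric] using finite_X by (intro card_mono) simp_all
  then have "l + 1 < k"
    using R R_irrefl[OF R(1)] finite_X by (simp add: l_def)
  moreover have "{z \<in> X. R a' z \<and> R b' z} \<subset> {z \<in> X. R a' z}"
    using N by auto
  then have "m < k"
    using psubset_card_mono[of "{z \<in> X. R a' z}"] finite_X degree[of a'] N by (simp add: m_def)
  moreover have "card {z \<in> X. R x z \<and> R y z} = l" if "x \<in> X" "y \<in> X" "R x y" for x y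
    using transitive_R[of a b x y] card_common_neighbours[of _ a b] R that by (auto simp: l_def)
  moreover have "card {z \<in> X. R x z \<and> R y z} = m" if "x \<in> X" "y \<in> X" "x \<noteq> y" "\<not> R x y" for x y
    using transitive_not_R[of a' b' x y] card_common_neighbours[of _ a' b'] N that by (auto simp: m_def)
  ultimately have "primitive_srg X R k l m"
    using finite_X R_sym R_irrefl degree by unfold_locales auto
  then show ?thesis by blast
qed

lemma primitive: "primitive_perm_group X G"
proof -
  have "P = {X} \<or> P = (\<lambda>x. {x}) ` X"
    if P: "partition_on X P" and inv: "\<forall>g\<in>G. \<forall>A\<in>P. g ` A \<in> P" for P
  proof -
    define Q where "Q x y \<longleftrightarrow> (\<exists>A\<in>P. x \<in> A \<and> y \<in> A)" for x y
    have PX: "\<Union>P = X" using partition_onD1[OF P] by simp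
    have disj: "A = B" if "A \<in> P" "B \<in> P" "x \<in> A" "x \<in> B" for A B x
      using partition_onD2[OF P] that by (auto simp: disjoint_def)
    have Q_trans: "Q x z" if "Q x y" "Q y z" for x y z
      using that disj unfolding Q_def by metis
    have Q_inv: "Q (g x) (g y)" if "g \<in> G" "Q x y" for g x y
      using that inv unfolding Q_def by blast
    have Q_all: "P = {X}" if all: "\<And>x y. x \<in> X \<Longrightarrow> y \<in> X \<Longrightarrow> Q x y"
    proof -
      have "A = X" if A: "A \<in> P" for A
      proof -
        have "A \<noteq> {}" using partition_onD3[OF P] A by auto
        then obtain x where x: "x \<in> A" by auto
        have "y \<in> A" if "y \<in> X" for y
          using all[of x y] x A PX that disj unfolding Q_def by blast
        then show ?thesis using A PX by auto
      qed
      moreover have "P \<noteq> {}" using PX path_R by auto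
      ultimately show ?thesis by auto
    qed
    have Q_R: "Q u v" if "x \<in> X" "y \<in> X" "R x y" "Q x y" "u \<in> X" "v \<in> X" "R u v" for x y u v
      using transitive_R[of x y u v] Q_inv that by metis
    have Q_N: "Q u v" if "x \<in> X" "y \<in> X" "x \<noteq> y" "\<not> R x y" "Q x y" "u \<in> X" "v \<in> X" "u \<noteq> v" "\<not> R u v" for x y u v
      using transitive_not_R[of x y u v] Q_inv that by metis
    have refl: "Q x x" if "x \<in> X" for x using that PX unfolding Q_def by blast
    show ?thesis
    proof (cases "\<exists>x\<in>X. \<exists>y\<in>X. x \<noteq> y \<and> Q x y")
      case True
      then obtain x y where xy: "x \<in> X" "y \<in> X" "x \<noteq> y" "Q x y" by blast
      obtain a b c where R: "a \<in> X" "b \<in> X" "c \<in> X" "R a b" "R b c" "a \<noteq> c" "\<not> R a c"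
        using path_R by blast
      obtain a' b' c' where N: "a' \<in> X" "b' \<in> X" "c' \<in> X" "a' \<noteq> b'" "b' \<noteq> c'" "\<not> R a' b'" "\<not> R b' c'" "R a' c'"
        using path_not_R by blast
      \<comment> \<open>Whichever relation holds between \<open>x\<close> and \<open>y\<close>, the
        block relation contains that whole orbit; transitivity along the corresponding path then
        gives a pair of the other orbit.\<close>
      have "Q a b \<and> Q a' b'"
      proof (cases "R x y")
        case True
        then have "Q a b" "Q b c" using Q_R[OF xy(1,2) _ xy(4)] R by auto
        then show ?thesis using Q_trans Q_N[of a c a' b'] R N by blast
      next
        case False
        then have "Q a' b'" "Q b' c'" using Q_N[OF xy(1,2,3) _ xy(4)] N by auto
        then show ?thesis using Q_trans Q_R[of a' c' a b] R N by blast
      qed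
      then have "Q u v" if "u \<in> X" "v \<in> X" for u v
        using Q_R[of a b u v] Q_N[of a' b' u v] that R N refl by metis
      then show ?thesis using Q_all by blast
    next
      case False
      have "A \<in> (\<lambda>x. {x}) ` X" if A: "A \<in> P" for A
      proof -
        have "A \<noteq> {}" using partition_onD3[OF P] A by auto
        then obtain x where x: "x \<in> A" by auto
        have "A = {x}" using False x A PX unfolding Q_def by blast
        then show ?thesis using x A PX by blast
      qed
      moreover have "{x} \<in> P" if x: "x \<in> X" for x
      proof -
        obtain A where A: "A \<in> P" "x \<in> A" using x PX by blast
        then have "A = {x}" using False PX unfolding Q_def by blast
        then show ?thesis using A by simp
      qed
      ultimately show ?thesis by blast
    qed
  qed
  then show ?thesis
    unfolding primitive_perm_group_def
    by (intro conjI allI impI ballI finite_X subgroup transitive) simp_all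
qed

lemma finite_G: "finite G"
  using finite_subset[of G "X \<rightarrow>\<^sub>E X"] G_funcset finite_PiE[of X "\<lambda>_. X"] finite_X by blast

text \<open>If \<open>h\<close> takes \<open>b\<close> to \<open>d\<close> and \<open>p\<close>
  takes \<open>c\<close> to \<open>a\<close>, then \<open>g \<mapsto> h g p\<close> embeds the first
  set into the second; exchanging the roles gives equality.\<close>

lemma card_transporter:
  assumes "a \<in> X" "b \<in> X" "c \<in> X" "d \<in> X"
  shows "card {g \<in> G. g a = b} = card {g \<in> G. g c = d}"
proof -
  have le: "card {g \<in> G. g a = b} \<le> card {g \<in> G. g c = d}"
    if X: "a \<in> X" "b \<in> X" "c \<in> X" "d \<in> X" for a b c d
  proof -
    obtain h p where h: "h \<in> G" "h b = d" and p: "p \<in> G" "p c = a"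
      using transitive X by metis
    interpret B: group "BijGroup X" by (rule group_BijGroup)
    have carrier: "g \<in> G \<Longrightarrow> g \<in> carrier (BijGroup X)" for g
      using subgroup.subset[OF subgroup] by blast
    have mult: "f \<otimes>\<^bsub>BijGroup X\<^esub> g = compose X f g" if "f \<in> G" "g \<in> G" for f g
      using that carrier by (auto simp: BijGroup_def)
    show ?thesis
    proof (rule card_inj_on_le)
      show "inj_on (\<lambda>g. h \<otimes>\<^bsub>BijGroup X\<^esub> (g \<otimes>\<^bsub>BijGroup X\<^esub> p)) {g \<in> G. g a = b}"
      proof (rule inj_onI)
        fix f g assume "f \<in> {g \<in> G. g a = b}" "g \<in> {g \<in> G. g a = b}"
          and eq: "h \<otimes>\<^bsub>BijGroup X\<^esub> (f \<otimes>\<^bsub>BijGroup X\<^esub> p) = h \<otimes>\<^bsub>BijGroup X\<^esub> (g \<otimes>\<^bsub>BijGroup X\<^esub> p)"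
        then have "f \<in> carrier (BijGroup X)" "g \<in> carrier (BijGroup X)"
          "h \<in> carrier (BijGroup X)" "p \<in> carrier (BijGroup X)"
          using carrier h p by blast+
        with eq show "f = g" by simp
      qed
      show "(\<lambda>g. h \<otimes>\<^bsub>BijGroup X\<^esub> (g \<otimes>\<^bsub>BijGroup X\<^esub> p)) ` {g \<in> G. g a = b} \<subseteq> {g \<in> G. g c = d}"
      proof safe
        fix g assume g: "g \<in> G" "b = g a"
        have gp: "g \<otimes>\<^bsub>BijGroup X\<^esub> p \<in> G" using subgroup.m_closed[OF subgroup] g p by blast
        then show "h \<otimes>\<^bsub>BijGroup X\<^esub> (g \<otimes>\<^bsub>BijGroup X\<^esub> p) \<in> G"
          using subgroup.m_closed[OF subgroup] h by blast
        show "(h \<otimes>\<^bsub>BijGroup X\<^esub> (g \<otimes>\<^bsub>BijGroup X\<^esub> p)) c = d"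
          using mult[OF h(1) gp] mult[OF g(1) p(1)] h p g X by (simp add: compose_def)
      qed
      show "finite {g \<in> G. g c = d}" using finite_G by simp
    qed
  qed
  show ?thesis using le[OF assms] le[OF assms(3,4,1,2)] by simp
qed

section \<open>Kernels of endomorphisms and the synchronization criterion\<close>

lemma kernel_class: "A \<in> kernel_partition X t \<Longrightarrow> \<exists>x\<in>X. A = {y \<in> X. t x = t y}"
  by (auto simp: kernel_partition_def quotient_def)

lemma uniform_of_inj: "inj_on t X \<Longrightarrow> uniform_partition (kernel_partition X t)"
proof -
  assume "inj_on t X"
  then have "card A = 1" if "A \<in> kernel_partition X t" for A
    using kernel_class[OF that] by (auto simp: inj_on_eq_iff card_1_singleton_iff)
  then show ?thesis by (simp add: uniform_partition_def)
qed

text \<open>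
  A translate of the clique \<^term>\<open>t ` X\<close> meets every kernel class of \<^term>\<open>t\<close> exactly once, so averaging over
  the transitive group \<^term>\<open>G\<close> determines the size of a kernel class.
\<close>

lemma uniform_of_clique:
  assumes t: "t \<in> X \<rightarrow> X" and hom: "\<And>u v. u \<in> X \<Longrightarrow> v \<in> X \<Longrightarrow> R u v \<Longrightarrow> R (t u) (t v)"
    and clique: "\<forall>u\<in>X. \<forall>v\<in>X. t u = t v \<or> R (t u) (t v)"
  shows "uniform_partition (kernel_partition X t)"
proof -
  obtain x0 where x0: "x0 \<in> X" using path_R by blast
  define c where "c = card {g \<in> G. g x0 = x0}"
  define K where "K = t ` X"
  have KX: "K \<subseteq> X" using t by (auto simp: K_def)
  have finite_K: "finite K" using finite_X by (simp add: K_def)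
  have card_class: "card A * (card K * c) = card G" if "A \<in> kernel_partition X t" for A
  proof -
    obtain x where x: "x \<in> X" and A: "A = {y \<in> X. t x = t y}" using kernel_class[OF \<open>A \<in> _\<close>] by blast
    have once: "card {k \<in> K. g k \<in> A} = 1" if g: "g \<in> G" for g
    proof -
      \<comment> \<open>Distinct points of the clique are adjacent, and both \<open>g\<close> and
        \<open>t\<close> preserve adjacency, so their images cannot coincide. Being finite,
        \<open>K\<close> is therefore permuted.\<close>
      have "inj_on (\<lambda>k. t (g k)) K"
      proof (rule inj_onI, rule ccontr)
        fix k k' assume k: "k \<in> K" "k' \<in> K" "t (g k) = t (g k')" "k \<noteq> k'"
        then have "R k k'" using clique by (auto simp: K_def)
        then have "R (t (g k)) (t (g k'))"
          using k g KX hom G_closed R_invariant by (meson subsetD)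
        then show False using k g KX G_closed R_irrefl t by (metis PiE subsetD)
      qed
      moreover have "(\<lambda>k. t (g k)) ` K \<subseteq> K" using KX G_closed[OF g] by (auto simp: K_def)
      ultimately have bij: "bij_betw (\<lambda>k. t (g k)) K K"
        using finite_K by (simp add: bij_betw_def endo_inj_surj)
      have "t x \<in> (\<lambda>k. t (g k)) ` K"
        unfolding bij_betw_imp_surj_on[OF bij] using x by (simp add: K_def)
      then obtain k where k: "k \<in> K" "t (g k) = t x" by auto
      have "g k \<in> X" using k(1) KX G_closed[OF g] by blast
      moreover have "j = k" if "j \<in> K" "t x = t (g j)" for j
        using inj_onD[OF bij_betw_imp_inj_on[OF bij], of j k] that(1) k(1)
          trans[OF that(2)[symmetric] k(2)[symmetric]] by blast
      ultimately have "{k \<in> K. g k \<in> A} = {k}"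
        using k(1) k(2)[symmetric] unfolding A by blast
      then show ?thesis by simp
    qed
    \<comment> \<open>The pairs \<open>(g, k)\<close> with \<open>g k \<in> A\<close> are counted
      twice: each \<open>g\<close> contributes exactly one, and each choice of \<open>k\<close> and
      \<open>a\<close> arises from \<open>c\<close> group elements.\<close>
    have "card G = (\<Sum>g\<in>G. card {k \<in> K. g k \<in> A})" using once by simp
    also have "\<dots> = (\<Sum>g\<in>G. \<Sum>k\<in>K. \<Sum>a\<in>A. of_bool (g k = a))"
    proof (intro sum.cong refl)
      fix g assume "g \<in> G"
      have "finite A" using finite_X by (simp add: A)
      then have "(\<Sum>a\<in>A. of_bool (g k = a)) = (of_bool (g k \<in> A) :: nat)" for k
        by (simp add: of_bool_def)
      then show "card {k \<in> K. g k \<in> A} = (\<Sum>k\<in>K. \<Sum>a\<in>A. of_bool (g k = a))"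
        using finite_K by (simp add: Int_def)
    qed
    also have "\<dots> = (\<Sum>k\<in>K. \<Sum>g\<in>G. \<Sum>a\<in>A. of_bool (g k = a))"
      by (rule sum.swap)
    also have "\<dots> = (\<Sum>k\<in>K. \<Sum>a\<in>A. \<Sum>g\<in>G. of_bool (g k = a))"
      by (intro sum.cong refl sum.swap)
    also have "\<dots> = (\<Sum>k\<in>K. \<Sum>a\<in>A. c)"
    proof (intro sum.cong refl)
      fix k a assume "k \<in> K" "a \<in> A"
      then have "card {g \<in> G. g k = a} = c"
        unfolding c_def using KX x0 by (intro card_transporter) (auto simp: A)
      then show "(\<Sum>g\<in>G. of_bool (g k = a)) = c" using finite_G by (simp add: Int_def)
    qed
    also have "\<dots> = card A * (card K * c)" by simp
    finally show ?thesis by simp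
  qed
  have "G \<noteq> {}" using transitive[OF x0 x0] by blast
  then have "card G \<noteq> 0" using finite_G by simp
  then show ?thesis
    unfolding uniform_partition_def using card_class by (metis mult_right_cancel mult_zero_right)
qed

lemma endomorphism_uniform:
  assumes "t \<in> X \<rightarrow> X" "\<And>u v. u \<in> X \<Longrightarrow> v \<in> X \<Longrightarrow> R u v \<Longrightarrow> R (t u) (t v)"
  shows "uniform_partition (kernel_partition X t)"
proof -
  obtain k l m where "primitive_srg X R k l m" using strongly_regular by blast
  then interpret primitive_srg X R k l m .
  have "inj_on t X \<or> (\<forall>u\<in>X. \<forall>v\<in>X. t u = t v \<or> R (t u) (t v))"
    using assms by (rule hom_injective_or_clique)
  then show ?thesis
    using uniform_of_inj uniform_of_clique[of t] assms by blast
qed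

text \<open>Images of uncollapsed pairs are uncollapsed, because whatever collapsed them would
  collapse the original pair after composition. Hence \<open>Q\<close> is respected by both
  \<open>G\<close> and \<open>t\<close>, and one pair in \<open>R\<close> brings the whole orbit
  into \<open>Q\<close>.\<close>

lemma uncollapsed_pair_uniform:
  assumes t: "t \<in> X \<rightarrow>\<^sub>E X" and p: "p \<in> X" "q \<in> X" "R p q"
    and sep: "\<And>f. f \<in> semigroup_generated X (insert t G) \<Longrightarrow> f p \<noteq> f q"
  shows "uniform_partition (kernel_partition X t)"
proof -
  let ?S = "semigroup_generated X (insert t G)"
  define Q where "Q u v \<longleftrightarrow> (\<forall>f\<in>?S. f u \<noteq> f v)" for u v
  have S: "f \<in> ?S" if "f \<in> insert t G" for f using that by (rule semigroup_generated.incl)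
  have Q_image: "Q (h u) (h v)" if "h \<in> ?S" "u \<in> X" "v \<in> X" "Q u v" for h u v
    using that semigroup_generated.comp[of _ X "insert t G" h] unfolding Q_def
    by (metis compose_eq)
  have RQ: "Q u v" if "u \<in> X" "v \<in> X" "R u v" for u v
    using transitive_R[OF p(1,2) that(1,2) p(3) that(3)] Q_image[OF _ p(1,2)] sep S
    unfolding Q_def by blast
  show ?thesis
  \<comment> \<open>If \<open>Q\<close> meets the other orbit as well, it consists of all pairs of
    distinct points and \<open>t\<close> is injective; otherwise \<open>Q\<close> is exactly
    \<open>R\<close> and \<open>t\<close> is an endomorphism.\<close>
  proof (cases "\<exists>u\<in>X. \<exists>v\<in>X. u \<noteq> v \<and> \<not> R u v \<and> Q u v")
    case True
    then obtain x y where xy: "x \<in> X" "y \<in> X" "x \<noteq> y" "\<not> R x y" "Q x y" by blast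
    have "Q u v" if "u \<in> X" "v \<in> X" "u \<noteq> v" for u v
      using transitive_not_R[OF xy(1,2) that(1,2) xy(3,4) that(3)] Q_image[OF _ xy(1,2,5)] S RQ that by blast
    then have "inj_on t X"
      using S unfolding inj_on_def Q_def by blast
    then show ?thesis by (rule uniform_of_inj)
  next
    case False
    show ?thesis
    proof (rule endomorphism_uniform)
      show "t \<in> X \<rightarrow> X" using t by auto
      show "R (t u) (t v)" if "u \<in> X" "v \<in> X" "R u v" for u v
      proof -
        have "Q u v" using that by (rule RQ)
        then have "Q (t u) (t v)" "t u \<noteq> t v" using Q_image[of t u v] S that unfolding Q_def by auto
        then show ?thesis using False t that by blast
      qed
    qed
  qed
qed

theorem almost_synchronizing: "almost_synchronizing X G"
  unfolding almost_synchronizing_def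
proof (intro conjI ballI impI)
  show "primitive_perm_group X G" by (rule primitive)
next
  fix t assume t: "t \<in> X \<rightarrow>\<^sub>E X" and nonuniform: "\<not> uniform_partition (kernel_partition X t)"
  let ?S = "semigroup_generated X (insert t G)"
  have S_funcset: "f \<in> X \<rightarrow>\<^sub>E X" if "f \<in> ?S" for f
    using that
  proof induction
    case (incl f) then show ?case using t G_funcset by blast
  next
    case (comp f g) then show ?case by (auto simp: compose_def)
  qed
  obtain f where f: "f \<in> ?S" and minimal: "\<And>g. g \<in> ?S \<Longrightarrow> card (f ` X) \<le> card (g ` X)"
    using arg_min_nat_lemma[of "\<lambda>f. f \<in> ?S" t "\<lambda>f. card (f ` X)"] semigroup_generated.incl by blast
  obtain x0 where x0: "x0 \<in> X" using path_R by blast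
  show "\<exists>c\<in>X. (\<lambda>x\<in>X. c) \<in> ?S"
  proof (cases "f ` X \<subseteq> {f x0}")
    case True
    then have "f = (\<lambda>x\<in>X. f x0)"
      using S_funcset[OF f] by (auto simp: fun_eq_iff PiE_def extensional_def)
    then show ?thesis using f S_funcset[OF f] x0 by (metis PiE_mem)
  next
    case False
    then obtain p q where pq: "p \<in> f ` X" "q \<in> f ` X" "p \<noteq> q" using x0 by blast
    have X: "p \<in> X" "q \<in> X" using pq S_funcset[OF f] by auto
    have sep: "g p \<noteq> g q" if g: "g \<in> ?S" for g
    proof
      assume eq: "g p = g q"
      have "f ` X = insert p (f ` X - {p})" using pq by blast
      then have "g ` f ` X = insert (g p) (g ` (f ` X - {p}))" by (metis image_insert)
      moreover have "g p \<in> g ` (f ` X - {p})" using eq pq by (intro image_eqI[of _ _ q]) simp_all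
      ultimately have "g ` f ` X = g ` (f ` X - {p})" by (metis insert_absorb)
      then have "card (g ` f ` X) \<le> card (f ` X - {p})"
        using card_image_le finite_X by (metis finite_Diff finite_imageI)
      also have "\<dots> < card (f ` X)" using pq finite_X by (simp add: card_Diff1_less del: card_Diff_insert)
      finally have "card (compose X g f ` X) < card (f ` X)"
        by (simp add: compose_def image_image)
      then show False using minimal[OF semigroup_generated.comp[OF g f]] by simp
    qed
    have "uniform_partition (kernel_partition X t)"
      using uncollapsed_pair_uniform[OF t X _ sep]
        rank3_group.uncollapsed_pair_uniform[OF complement t X _ sep] pq(3) by blast
    then show ?thesis using nonuniform by contradiction
  qed
qed

end

section \<open>Affine maps with square multiplier\<close>

text \<open>Translation by 1 leaves the sum of all field elements unchanged, so the order of the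
  field annihilates 1. An odd number cannot do so if 2 does.\<close>

lemma odd_card_one_plus_one:
  assumes "odd CARD('f::{field,finite})"
  shows "(1::'f) + 1 \<noteq> 0"
proof
  assume two: "(1::'f) + 1 = 0"
  have "(\<Sum>x\<in>(UNIV::'f set). x) = (\<Sum>x\<in>UNIV. x + 1)"
    by (rule sum.reindex_bij_witness[of _ "\<lambda>x. x + 1" "\<lambda>x. x - 1"]) auto
  then have "of_nat CARD('f) = (0::'f)"
    by (simp add: sum.distrib)
  moreover obtain r where "CARD('f) = 2 * r + 1" using assms by (rule oddE)
  moreover have "(2::'f) = 0" using two by (metis one_add_one)
  ultimately show False by simp
qed

section \<open>Squares in a finite field of odd order\<close>

definition nonzero_squares :: "'f::field set" where
  "nonzero_squares = {c\<^sup>2 | c. c \<noteq> 0}"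

lemma one_nonzero_square: "1 \<in> nonzero_squares"
  by (auto simp: nonzero_squares_def intro: exI[of _ 1])

lemma nonzero_squares_mult: "a \<in> nonzero_squares \<Longrightarrow> b \<in> nonzero_squares \<Longrightarrow> a * b \<in> nonzero_squares"
  unfolding nonzero_squares_def by (clarsimp, metis mult_eq_0_iff power_mult_distrib)

lemma nonzero_squares_inverse: "a \<in> nonzero_squares \<Longrightarrow> inverse a \<in> nonzero_squares"
  unfolding nonzero_squares_def by (clarsimp, metis inverse_nonzero_iff_nonzero power_inverse)

lemma nonzero_squares_nonzero: "a \<in> nonzero_squares \<Longrightarrow> a \<noteq> 0"
  by (auto simp: nonzero_squares_def)

lemma nonzero_squares_mult_iff:
  "a \<in> nonzero_squares \<Longrightarrow> a * b \<in> nonzero_squares \<longleftrightarrow> b \<in> nonzero_squares"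
  using nonzero_squares_mult[of a b] nonzero_squares_mult[OF nonzero_squares_inverse, of a "a * b"]
    nonzero_squares_nonzero[of a] by (auto simp flip: mult.assoc)

text \<open>Squaring is two-to-one on the nonzero elements: its fibres are \<open>{c, - c}\<close>,
  with \<open>c \<noteq> - c\<close> in odd characteristic.\<close>

lemma card_nonzero_squares:
  assumes odd: "odd CARD('f::{field,finite})"
  shows "2 * card (nonzero_squares :: 'f set) = CARD('f) - 1"
proof -
  have ne: "(1::'f) + 1 \<noteq> 0" by (rule odd_card_one_plus_one[OF odd])
  have neq: "x \<noteq> - x" if "x \<noteq> 0" for x :: 'f
  proof
    assume "x = - x"
    then have "x * (1 + 1) = 0" by (metis add.right_inverse distrib_left mult_1_right)
    then show False using that ne by simp
  qed
  have "card (UNIV - {0::'f}) = (\<Sum>q\<in>(nonzero_squares::'f set). card {x. x \<noteq> 0 \<and> x\<^sup>2 = q})"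
  proof -
    have "UNIV - {0::'f} = (\<Union>q\<in>nonzero_squares. {x. x \<noteq> 0 \<and> x\<^sup>2 = q})"
      by (auto simp: nonzero_squares_def)
    also have "card \<dots> = (\<Sum>q\<in>(nonzero_squares::'f set). card {x. x \<noteq> 0 \<and> x\<^sup>2 = q})"
      by (rule card_UN_disjoint) auto
    finally show ?thesis .
  qed
  also have "\<dots> = (\<Sum>q\<in>(nonzero_squares::'f set). 2)"
  proof (rule sum.cong[OF refl])
    fix q :: 'f assume "q \<in> nonzero_squares"
    then obtain c where c: "q = c\<^sup>2" "c \<noteq> 0" by (auto simp: nonzero_squares_def)
    then have "{x. x \<noteq> 0 \<and> x\<^sup>2 = q} = {c, - c}" by (auto simp: power2_eq_iff)
    then show "card {x. x \<noteq> 0 \<and> x\<^sup>2 = q} = 2" using neq[OF c(2)] by simp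
  qed
  finally show ?thesis by (simp add: card_Diff_singleton)
qed

text \<open>By counting, the nonzero squares and their multiples by \<open>a\<close> fill the
  nonzero elements. So \<open>b\<close> is \<open>a\<close> times a square \<open>q\<close>, and
  \<open>a b = a^2 q\<close>.\<close>

lemma nonsquare_mult_nonsquare:
  assumes odd: "odd CARD('f::{field,finite})"
    and a: "a \<noteq> (0::'f)" "a \<notin> nonzero_squares" and b: "b \<noteq> 0" "b \<notin> nonzero_squares"
  shows "a * b \<in> nonzero_squares"
proof -
  let ?Q = "nonzero_squares :: 'f set"
  have inj: "inj_on ((*) a) ?Q" using a by (auto simp: inj_on_def)
  have disj: "?Q \<inter> (*) a ` ?Q = {}"
    using a nonzero_squares_mult_iff[of _ a] by (auto simp: mult.commute)
  have "card (?Q \<union> (*) a ` ?Q) = card (UNIV - {0::'f})"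
    using card_nonzero_squares[OF odd] disj inj
    by (simp add: card_Un_disjoint card_image card_Diff_singleton)
  moreover have "?Q \<union> (*) a ` ?Q \<subseteq> UNIV - {0}"
    using a nonzero_squares_nonzero by auto
  ultimately have "?Q \<union> (*) a ` ?Q = UNIV - {0}" by (intro card_subset_eq) auto
  then obtain q where "b = a * q" "q \<in> ?Q" using b by auto
  moreover have "a * a \<in> ?Q" using a by (auto simp: nonzero_squares_def power2_eq_square)
  ultimately show ?thesis using nonzero_squares_mult[of "a * a" q] by (simp add: mult.assoc)
qed

text \<open>Inversion fixes only \<^term>\<open>1\<close> and \<^term>\<open>- 1\<close>, so it decides the parity of the number of nonzero squares.\<close>

lemma minus_one_square:
  assumes odd: "odd CARD('f::{field,finite})" and "4 dvd CARD('f) - 1"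
  shows "(- 1 :: 'f) \<in> nonzero_squares"
proof (rule ccontr)
  assume not: "(- 1 :: 'f) \<notin> nonzero_squares"
  let ?Q = "nonzero_squares :: 'f set"
  have "even (card ?Q)" using assms(2) card_nonzero_squares[OF odd] by presburger
  define P where "P = (\<lambda>x. {x, inverse x}) ` (?Q - {1})"
  have "card (\<Union>P) = 2 * card P"
  proof -
    have "card A = 2" if "A \<in> P" for A
    proof -
      obtain x where x: "x \<in> ?Q" "x \<noteq> 1" "A = {x, inverse x}" using \<open>A \<in> P\<close> by (auto simp: P_def)
      have "x \<noteq> inverse x"
      proof
        assume "x = inverse x"
        then have "x * x = 1" using nonzero_squares_nonzero[OF x(1)] by (metis right_inverse)
        then show False using x not by (auto simp: square_eq_1_iff)
      qed
      then show ?thesis using x by simp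
    qed
    moreover have "A \<inter> B = {}" if "A \<in> P" "B \<in> P" "A \<noteq> B" for A B
      using that by (auto simp: P_def)
    moreover have "finite P" by (simp add: P_def)
    ultimately show ?thesis
      using card_partition[of P 2] by simp
  qed
  moreover have "\<Union>P = ?Q - {1}" using nonzero_squares_inverse by (auto simp: P_def)
  ultimately have "even (card (?Q - {1}))" by simp
  moreover have "card ?Q = Suc (card (?Q - {1}))" using one_nonzero_square by (intro card.remove) simp_all
  ultimately show False using \<open>even (card ?Q)\<close> by simp
qed

section \<open>The affine group and the Paley graph\<close>

lemma mem_affine_square_group:
  "f \<in> affine_square_group \<longleftrightarrow> (\<exists>a b. f = (\<lambda>x. a * x + b) \<and> a \<in> nonzero_squares)"
  by (auto simp: affine_square_group_def nonzero_squares_def)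

lemma affine_square_group_subgroup:
  "subgroup affine_square_group (BijGroup (UNIV :: 'f::field set))"
proof -
  have aff: "bij (\<lambda>x. a * x + b)" if "a \<noteq> 0" for a b :: 'f
    using that by (intro bij_betwI[of _ _ _ "\<lambda>x. (x - b) / a"]) (auto simp: field_simps)
  have sub: "affine_square_group \<subseteq> carrier (BijGroup (UNIV :: 'f set))"
  proof
    fix f :: "'f \<Rightarrow> 'f" assume "f \<in> affine_square_group"
    then obtain a b where "f = (\<lambda>x. a * x + b)" "a \<in> nonzero_squares" using mem_affine_square_group by blast
    then show "f \<in> carrier (BijGroup UNIV)"
      using aff[OF nonzero_squares_nonzero, of a b] by (simp add: BijGroup_def Bij_def)
  qed
  interpret B: group "BijGroup (UNIV :: 'f set)" by (rule group_BijGroup)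
  show ?thesis
  proof (rule B.subgroupI[OF sub])
    have "(\<lambda>x::'f. 1 * x + 0) \<in> affine_square_group"
      unfolding mem_affine_square_group using one_nonzero_square by blast
    then show "affine_square_group \<noteq> ({} :: ('f \<Rightarrow> 'f) set)" by blast
    fix f :: "'f \<Rightarrow> 'f" assume f: "f \<in> affine_square_group"
    then obtain a b where ab: "f = (\<lambda>x. a * x + b)" "a \<in> nonzero_squares" using mem_affine_square_group by blast
    have a0: "a \<noteq> 0" using ab nonzero_squares_nonzero by blast
    have "inv_into UNIV f = (\<lambda>x. inverse a * x + (- inverse a * b))"
    proof
      fix y
      have "f (inverse a * y + (- inverse a * b)) = y" using a0 by (simp add: ab field_simps)
      moreover have "inj f" using aff[OF a0, of b] by (simp add: ab bij_is_inj)
      ultimately show "inv_into UNIV f y = inverse a * y + (- inverse a * b)" by (metis inv_f_f)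
    qed
    moreover have "inv\<^bsub>BijGroup UNIV\<^esub> f = inv_into UNIV f"
    proof -
      have "f \<in> carrier (BijGroup UNIV)" using f sub by blast
      then show ?thesis using inv_BijGroup[of f UNIV] by (simp add: BijGroup_def restrict_UNIV)
    qed
    ultimately show "inv\<^bsub>BijGroup UNIV\<^esub> f \<in> affine_square_group"
      unfolding mem_affine_square_group using nonzero_squares_inverse[OF ab(2)] by metis
    fix g :: "'f \<Rightarrow> 'f" assume g: "g \<in> affine_square_group"
    then obtain c d where cd: "g = (\<lambda>x. c * x + d)" "c \<in> nonzero_squares" using mem_affine_square_group by blast
    have "f \<otimes>\<^bsub>BijGroup UNIV\<^esub> g = compose UNIV f g"
      using f g sub by (auto simp: BijGroup_def)
    also have "\<dots> = (\<lambda>x. (a * c) * x + (a * d + b))"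
      by (auto simp: compose_def ab cd algebra_simps)
    finally show "f \<otimes>\<^bsub>BijGroup UNIV\<^esub> g \<in> affine_square_group"
      unfolding mem_affine_square_group using nonzero_squares_mult[OF ab(2) cd(2)] by blast
  qed
qed

text \<open>The invariant graph joins elements whose difference is a nonzero square, which is the
  Paley graph. The divisibility by 4 makes -1 a square and so makes the relation symmetric.\<close>

theorem affine_square_group_almost_synchronizing:
  assumes odd: "odd CARD('f::{field,finite})" and four: "4 dvd CARD('f) - 1"
  shows "almost_synchronizing (UNIV :: 'f set) affine_square_group"
proof -
  let ?Q = "nonzero_squares :: 'f set"
  note neg = minus_one_square[OF odd four]
  have two: "(1::'f) + 1 \<noteq> 0" by (rule odd_card_one_plus_one[OF odd])
  have Q_minus: "- x \<in> ?Q \<longleftrightarrow> x \<in> ?Q" for x using nonzero_squares_mult_iff[OF neg, of x] by simp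
  have Q_sq: "c * c \<in> ?Q" if "c \<noteq> 0" for c using that by (auto simp: nonzero_squares_def power2_eq_square)
  have "\<not> UNIV - {0} \<subseteq> ?Q"
  proof
    assume "UNIV - {0} \<subseteq> ?Q"
    then have "card (UNIV - {0::'f}) \<le> card ?Q" by (intro card_mono) auto
    moreover have "CARD('f) > 1" using card_mono[of UNIV "{0::'f, 1}"] by simp
    ultimately show False using card_nonzero_squares[OF odd] by (simp add: card_Diff_singleton)
  qed
  then obtain r where r: "r \<noteq> 0" "r \<notin> ?Q" by auto
  obtain i :: 'f where i: "i * i = - 1" using neg by (auto simp: nonzero_squares_def power2_eq_square)
  \<comment> \<open>The aim is to write the nonsquare \<open>r\<close> as a sum of two squares. It
    is the difference of the squares of \<open>(r + 1) / 2\<close> and \<open>(r - 1) / 2\<close>,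
    and \<open>i\<close> with \<open>i^2 = -1\<close> turns the minus sign into a plus.\<close>
  define s where "s = (r + 1) / (1 + 1)"
  define h where "h = (r - 1) / (1 + 1)"
  define t where "t = i * h"
  have "t * t = (i * i) * (h * h)" by (simp add: t_def mult_ac)
  then have "s * s + t * t = s * s - h * h" by (simp add: i)
  also have "\<dots> = ((r + 1) * (r + 1) - (r - 1) * (r - 1)) / ((1 + 1) * (1 + 1))"
    unfolding s_def h_def times_divide_times_eq by (rule diff_divide_distrib[symmetric])
  also have "(r + 1) * (r + 1) - (r - 1) * (r - 1) = r * ((1 + 1) * (1 + 1))"
    by (simp add: algebra_simps)
  finally have st: "s * s + t * t = r" using two by (simp only: nonzero_mult_div_cancel_right mult_eq_0_iff simp_thms)
  have s0: "s \<noteq> 0" and t0: "t \<noteq> 0"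
    using st r Q_sq[of s] Q_sq[of t] by auto
  have r_mult: "r * c \<notin> ?Q" if "c \<in> ?Q" for c
    using nonzero_squares_mult_iff[OF that, of r] r by (simp add: mult.commute)
  define R where "R x y \<longleftrightarrow> x - y \<in> ?Q" for x y :: 'f
  have "rank3_group (UNIV :: 'f set) affine_square_group R"
  proof (rule rank3_group.intro)
    show "subgroup affine_square_group (BijGroup (UNIV :: 'f set))"
      by (rule affine_square_group_subgroup)
    show "R y x" if "R x y" for x y using that Q_minus[of "x - y"] by (simp add: R_def)
    show "\<not> R x x" for x using nonzero_squares_nonzero by (auto simp: R_def)
    show "R (g x) (g y) \<longleftrightarrow> R x y" if g: "g \<in> affine_square_group" for g x y
    proof -
      obtain a b where "g = (\<lambda>x. a * x + b)" "a \<in> ?Q"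
        using g mem_affine_square_group by blast
      then show ?thesis
        using nonzero_squares_mult_iff[of a "x - y"] by (simp add: R_def algebra_simps)
    qed
    \<comment> \<open>The slope is forced to be the quotient of the two differences, so all that
      matters is that they lie in the same class modulo squares.\<close>
    have map: "\<exists>g\<in>affine_square_group. g x = u \<and> g y = v" if "x \<noteq> y" "(u - v) * inverse (x - y) \<in> ?Q" for x y u v :: 'f
    proof
      define a where "a = (u - v) * inverse (x - y)"
      show "(\<lambda>z. a * z + (u - a * x)) \<in> affine_square_group"
        using that(2) unfolding mem_affine_square_group a_def by blast
      have "a * (x - y) = u - v" using that(1) by (simp add: a_def)
      then show "a * x + (u - a * x) = u \<and> a * y + (u - a * x) = v" by (simp add: algebra_simps)
    qed
    show "\<exists>g\<in>affine_square_group. g x = u \<and> g y = v" if "R x y" "R u v" for x y u v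
    proof (rule map)
      show "x \<noteq> y" using that nonzero_squares_nonzero[of "x - y"] by (auto simp: R_def)
      show "(u - v) * inverse (x - y) \<in> ?Q"
        using that nonzero_squares_mult nonzero_squares_inverse by (auto simp: R_def)
    qed
    show "\<exists>g\<in>affine_square_group. g x = u \<and> g y = v" if "x \<noteq> y" "\<not> R x y" "u \<noteq> v" "\<not> R u v" for x y u v
    proof (rule map[OF that(1)])
      have "inverse (x - y) \<notin> ?Q" using that nonzero_squares_inverse[of "inverse (x - y)"] by (auto simp: R_def)
      then show "(u - v) * inverse (x - y) \<in> ?Q"
        using that nonsquare_mult_nonsquare[OF odd] by (auto simp: R_def)
    qed
    show "\<exists>g\<in>affine_square_group. g x = y" for x y :: 'f
    proof
      show "(\<lambda>z. 1 * z + (y - x)) \<in> affine_square_group"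
        unfolding mem_affine_square_group using one_nonzero_square by blast
    qed simp
    \<comment> \<open>The successive differences are the squares \<open>s^2\<close> and
      \<open>t^2\<close>, while the ends differ by the nonsquare \<open>r\<close>.\<close>
    have "R (s * s) 0" "R 0 (- (t * t))" "\<not> R (s * s) (- (t * t))" "s * s \<noteq> - (t * t)"
      using Q_sq s0 t0 st r by (auto simp: R_def eq_neg_iff_add_eq_0)
    then show "\<exists>a\<in>UNIV. \<exists>b\<in>UNIV. \<exists>c\<in>UNIV. R a b \<and> R b c \<and> a \<noteq> c \<and> \<not> R a c" by blast
    \<comment> \<open>Multiplying the previous path by \<open>r\<close> exchanges squares and
      nonsquares among its differences, since the outer one becomes \<open>r^2\<close>.\<close>
    have "r * (s * s) + r * (t * t) = r * r" by (simp add: st flip: distrib_left)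
    then have "\<not> R (r * (s * s)) 0" "\<not> R 0 (- (r * (t * t)))" "R (r * (s * s)) (- (r * (t * t)))"
      "r * (s * s) \<noteq> 0" "0 \<noteq> - (r * (t * t))"
      using Q_sq s0 t0 r r_mult by (auto simp: R_def)
    then show "\<exists>a\<in>UNIV. \<exists>b\<in>UNIV. \<exists>c\<in>UNIV. a \<noteq> b \<and> b \<noteq> c \<and> \<not> R a b \<and> \<not> R b c \<and> R a c" by blast
  qed simp
  then show ?thesis by (rule rank3_group.almost_synchronizing)
qed

section \<open>Semilinear maps on projective space\<close>

lemma action_on_subgroup:
  assumes G: "subgroup G (BijGroup X)" and Y: "Y \<subseteq> X" "finite Y"
    and inv: "\<And>g. g \<in> G \<Longrightarrow> g ` Y \<subseteq> Y"
  shows "subgroup (action_on Y G) (BijGroup Y)"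
proof -
  interpret BX: group "BijGroup X" by (rule group_BijGroup)
  interpret BY: group "BijGroup Y" by (rule group_BijGroup)
  have G_Bij: "g \<in> Bij X" if "g \<in> G" for g
    using subgroup.subset[OF G] that by (auto simp: BijGroup_def)
  have restr_Bij: "restrict g Y \<in> Bij Y" if "g \<in> G" for g
  proof -
    have "inj_on g Y"
      using Y G_Bij[OF that] by (auto simp: Bij_def bij_betw_def intro: inj_on_subset)
    moreover have "g ` Y = Y" using endo_inj_surj[OF Y(2) inv[OF that] calculation] .
    ultimately have "bij_betw (restrict g Y) Y Y"
      by (simp add: bij_betw_def inj_on_restrict_eq)
    then show ?thesis by (simp add: Bij_def)
  qed
  have mult: "restrict f Y \<otimes>\<^bsub>BijGroup Y\<^esub> restrict g Y = restrict (f \<otimes>\<^bsub>BijGroup X\<^esub> g) Y"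
    if "f \<in> G" "g \<in> G" for f g
    using restr_Bij[OF that(1)] restr_Bij[OF that(2)] G_Bij[OF that(1)] G_Bij[OF that(2)] inv[OF that(2)] Y(1)
    by (auto simp: BijGroup_def compose_def restrict_def fun_eq_iff subset_iff)
  show ?thesis
  proof (rule BY.subgroupI)
    show "action_on Y G \<subseteq> carrier (BijGroup Y)"
      using restr_Bij by (auto simp: action_on_def BijGroup_def)
    show "action_on Y G \<noteq> {}"
      using subgroup.one_closed[OF G] by (auto simp: action_on_def)
    fix a assume "a \<in> action_on Y G"
    then obtain g where g: "g \<in> G" "a = restrict g Y" by (auto simp: action_on_def)
    have g': "inv\<^bsub>BijGroup X\<^esub> g \<in> G" using subgroup.m_inv_closed[OF G g(1)] .
    have "restrict (inv\<^bsub>BijGroup X\<^esub> g) Y \<otimes>\<^bsub>BijGroup Y\<^esub> a = restrict \<one>\<^bsub>BijGroup X\<^esub> Y"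
      using mult[OF g' g(1)] subgroup.mem_carrier[OF G g(1)] by (simp add: g(2))
    also have "\<dots> = \<one>\<^bsub>BijGroup Y\<^esub>" using Y(1) by (simp add: BijGroup_def Int_absorb1)
    finally have "inv\<^bsub>BijGroup Y\<^esub> a = restrict (inv\<^bsub>BijGroup X\<^esub> g) Y"
      using restr_Bij[OF g(1)] restr_Bij[OF g'] by (intro BY.inv_equality) (auto simp: BijGroup_def g(2))
    then show "inv\<^bsub>BijGroup Y\<^esub> a \<in> action_on Y G" using g' by (simp add: action_on_def)
    fix b assume "b \<in> action_on Y G"
    then obtain h where h: "h \<in> G" "b = restrict h Y" by (auto simp: action_on_def)
    show "a \<otimes>\<^bsub>BijGroup Y\<^esub> b \<in> action_on Y G"
      using mult[OF g(1) h(1)] subgroup.m_closed[OF G g(1) h(1)] by (simp add: action_on_def g h)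
  qed
qed

section \<open>Semilinear bijections and subspaces\<close>

context
  fixes f :: "'k::field ^ 'n::finite \<Rightarrow> 'k ^ 'n"
  assumes f: "f \<in> GammaL"
begin

lemma GammaL_bij: "bij f"
  using f by (simp add: GammaL_def)

lemma GammaL_add: "f (x + y) = f x + f y"
  using f by (auto simp: GammaL_def semilinear_def)

lemma GammaL_zero: "f 0 = 0"
  using GammaL_add[of 0 0] by simp

lemma GammaL_eq_0_iff: "f x = 0 \<longleftrightarrow> x = 0"
  using GammaL_bij GammaL_zero by (metis bij_is_inj injD)

lemma GammaL_subspace: "vec.subspace U \<Longrightarrow> vec.subspace (f ` U)"
proof -
  assume U: "vec.subspace U"
  obtain \<sigma> where \<sigma>: "field_automorphism \<sigma>" "semilinear \<sigma> f" using f by (auto simp: GammaL_def)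
  show ?thesis
  proof (rule vec.subspaceI)
    show "0 \<in> f ` U" using GammaL_zero vec.subspace_0[OF U] by (metis imageI)
    show "x + y \<in> f ` U" if "x \<in> f ` U" "y \<in> f ` U" for x y
      using that vec.subspace_add[OF U] by (auto simp: GammaL_add[symmetric])
    show "c *s x \<in> f ` U" if x: "x \<in> f ` U" for c x
    proof -
      \<comment> \<open>A semilinear map twists scalars, so \<open>c\<close> has to be pulled back
        through the surjective \<open>\<sigma>\<close> before scaling in \<open>U\<close>.\<close>
      obtain d where "c = \<sigma> d" using \<sigma>(1) unfolding field_automorphism_def by (metis bij_is_surj surjD)
      moreover obtain u where "u \<in> U" "x = f u" using x by blast
      ultimately have "c *s x = f (d *s u)" using \<sigma>(2) by (simp add: semilinear_def)
      then show ?thesis using vec.subspace_scale[OF U] \<open>u \<in> U\<close> by blast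
    qed
  qed
qed

lemma GammaL_span: "f ` vec.span S = vec.span (f ` S)"
proof (rule subset_antisym)
  show "vec.span (f ` S) \<subseteq> f ` vec.span S"
    by (rule vec.span_minimal) (auto intro: GammaL_subspace vec.span_base)
  obtain \<sigma> where \<sigma>: "semilinear \<sigma> f" using f by (auto simp: GammaL_def)
  have "f x \<in> vec.span (f ` S)" if "x \<in> vec.span S" for x
    using that
  proof (induction rule: vec.span_induct_alt)
    case base then show ?case by (simp add: GammaL_zero vec.span_zero)
  next
    case (step c x y)
    have "f (c *s x + y) = \<sigma> c *s f x + f y" using \<sigma> by (simp add: semilinear_def)
    then show ?case
      using step by (simp add: vec.span_add vec.span_scale vec.span_base)
  qed
  then show "f ` vec.span S \<subseteq> vec.span (f ` S)" by blast
qed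

lemma GammaL_independent: "vec.independent S \<Longrightarrow> vec.independent (f ` S)"
proof
  assume S: "vec.independent S" and "vec.dependent (f ` S)"
  then obtain a where a: "a \<in> S" "f a \<in> vec.span (f ` S - {f a})"
    by (auto simp: vec.dependent_def[of "f ` S"])
  have "f ` S - {f a} = f ` (S - {a})"
    using GammaL_bij a(1) by (auto dest: bij_is_inj injD)
  then have "f a \<in> f ` vec.span (S - {a})" using a(2) by (simp add: GammaL_span)
  then have "a \<in> vec.span (S - {a})"
    using GammaL_bij by (metis bij_is_inj inj_image_mem_iff)
  then show False using S a(1) by (auto simp: vec.dependent_def)
qed

text \<open>A semilinear bijection carries spans to spans and independent sets to independent sets,
  hence a basis to a basis of the same size.\<close>

lemma GammaL_dim: "vec.dim (f ` U) = vec.dim U"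
proof -
  obtain B where B: "B \<subseteq> U" "vec.independent B" "U \<subseteq> vec.span B" "card B = vec.dim U"
    by (rule vec.basis_exists)
  have "f ` U \<subseteq> vec.span (f ` B)" using B(3) GammaL_span[of B] by blast
  moreover have "card (f ` B) = vec.dim U"
    using B(4) GammaL_bij by (metis bij_is_inj card_image inj_on_subset subset_UNIV)
  ultimately show ?thesis
    using vec.dim_unique[of "f ` B" "f ` U"] B(1) GammaL_independent[OF B(2)] by blast
qed

lemma GammaL_proj_points: "U \<in> proj_points \<Longrightarrow> f ` U \<in> proj_points"
  by (simp add: proj_points_def GammaL_subspace GammaL_dim)

lemma GammaL_proj_lines: "U \<in> proj_lines \<Longrightarrow> f ` U \<in> proj_lines"
  by (simp add: proj_lines_def GammaL_subspace GammaL_dim)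

lemma GammaL_proj_map: "U \<in> subspaces \<Longrightarrow> proj_map f U = f ` U"
  by (simp add: proj_map_def)

end

lemma proj_points_subspaces: "proj_points \<subseteq> subspaces"
  by (auto simp: proj_points_def subspaces_def)

lemma proj_lines_subspaces: "proj_lines \<subseteq> subspaces"
  by (auto simp: proj_lines_def subspaces_def)

lemma proj_map_BijGroup:
  fixes f :: "'k::{field,finite} ^ 'n::finite \<Rightarrow> 'k ^ 'n"
  assumes "f \<in> GammaL"
  shows "proj_map f \<in> carrier (BijGroup subspaces)"
proof -
  have inj: "inj_on (proj_map f) subspaces"
    by (rule inj_onI) (simp add: proj_map_def inj_image_eq_iff[OF bij_is_inj[OF GammaL_bij[OF assms]]])
  have "proj_map f ` subspaces \<subseteq> subspaces"
    using GammaL_subspace[OF assms] by (auto simp: proj_map_def subspaces_def)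
  then have "proj_map f ` subspaces = subspaces"
    using inj by (intro endo_inj_surj) simp_all
  with inj have "bij_betw (proj_map f) subspaces subspaces" by (rule bij_betw_imageI)
  then show ?thesis by (simp add: BijGroup_def Bij_def proj_map_def)
qed

text \<open>The vectors extend to a basis that fills the remaining columns, and the unconstrained
  column \<open>j\<close> absorbs the determinant. The matrix is built by rows and transposed at the
  end.\<close>

lemma matrix_with_columns:
  fixes v :: "'n::finite \<Rightarrow> 'k::field ^ 'n"
  assumes inj: "inj_on v I" and indep: "vec.independent (v ` I)" and j: "j \<notin> I"
  shows "\<exists>A. det A = 1 \<and> (\<forall>i\<in>I. A *v axis i 1 = v i)"
proof -
  obtain B where B: "v ` I \<subseteq> B" "vec.independent B" "UNIV \<subseteq> vec.span B"
    using vec.maximal_independent_subset_extend[OF subset_UNIV indep] by metis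
  have "card B = CARD('n)"
    using vec.basis_card_eq_dim[of B UNIV] B vec_dim_card by auto
  moreover have finite_B: "finite B" using B(2) by (rule vec.finiteI_independent)
  ultimately have "card (- I) = card (B - v ` I)"
    using B(1) inj by (simp add: card_Diff_subset card_image Compl_eq_Diff_UNIV)
  then obtain h where h: "bij_betw h (- I) (B - v ` I)"
    using finite_B finite_same_card_bij[of "- I" "B - v ` I"] by auto
  define w where "w i = (if i \<in> I then v i else h i)" for i
  have "range w = v ` I \<union> h ` (- I)" by (auto simp: w_def)
  then have range_w: "range w = B"
    using B(1) h by (auto simp: bij_betw_def)
  define W where "W = (\<chi> i. w i)"
  have "rows W = range w" by (auto simp: rows_def W_def row_def)
  then have "det W \<noteq> 0"
    using B(3) matrix_left_invertible_span_rows_gen[of W] range_w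
    by (auto simp: invertible_det_nz[symmetric] invertible_left_inverse)
  define W' where "W' = (\<chi> i. if i = j then inverse (det W) *s w i else w i)"
  have "W = (\<chi> i. if i = j then w i else w i)" by (simp add: W_def)
  then have "det W' = 1"
    using \<open>det W \<noteq> 0\<close> det_row_mul[of j "inverse (det W)" w w] by (simp add: W'_def)
  moreover have "transpose W' *v axis i 1 = v i" if "i \<in> I" for i
  proof -
    have "transpose W' *v axis i 1 = W' $ i"
      by (simp add: vec_eq_iff matrix_vector_mult_def transpose_def axis_def if_distrib cong: if_cong)
    then show ?thesis using that j by (auto simp: W'_def w_def)
  qed
  ultimately show ?thesis using det_transpose by metis
qed

text \<open>Both lists are images of the same unit vectors, under \<open>A\<close> and
  \<open>B\<close> of determinant 1, so \<open>B\<close> times the inverse of \<open>A\<close>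
  works. The strict bound on the length leaves an index for normalizing the determinant; two skew
  lines use four vectors, and dimension at least 5 provides it.\<close>

lemma SL_transitive_lists:
  fixes vs ws :: "('k::field ^ 'n::finite) list"
  assumes vs: "distinct vs" "vec.independent (set vs)" and ws: "distinct ws" "vec.independent (set ws)"
    and len: "length vs = length ws" "length vs < CARD('n)"
  shows "\<exists>f\<in>SL. map f vs = ws"
proof -
  let ?r = "length vs"
  obtain e :: "nat \<Rightarrow> 'n" where e: "inj_on e {..<?r}"
    using len(2) card_le_inj[of "{..<?r}" "UNIV :: 'n set"] by auto
  define I where "I = e ` {..<?r}"
  have "card I < CARD('n)" using e len(2) by (simp add: I_def card_image)
  then obtain j where j: "j \<notin> I" by (metis UNIV_eq_I nat_less_le)
  define idx where "idx = inv_into {..<?r} e"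
  have idx: "idx (e i) = i" if "i < ?r" for i
    using that e by (simp add: idx_def)
  have idx_less: "idx i < ?r" if "i \<in> I" for i
    using that idx by (auto simp: I_def)
  have cols: "\<exists>A. det A = 1 \<and> (\<forall>i\<in>I. A *v axis i 1 = us ! idx i)"
    if us: "distinct us" "vec.independent (set us)" "length us = ?r" for us :: "('k ^ 'n) list"
  proof (rule matrix_with_columns[OF _ _ j])
    show "inj_on (\<lambda>i. us ! idx i) I"
      using us idx by (auto simp: inj_on_def I_def nth_eq_iff_index_eq)
    have "(\<lambda>i. us ! idx i) ` I \<subseteq> set us"
      using idx_less us(3) by auto
    then show "vec.independent ((\<lambda>i. us ! idx i) ` I)"
      using us(2) vec.independent_mono by blast
  qed
  obtain A where A: "det A = 1" "\<And>i. i \<in> I \<Longrightarrow> A *v axis i 1 = vs ! idx i" using cols[OF vs] by auto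
  obtain B where B: "det B = 1" "\<And>i. i \<in> I \<Longrightarrow> B *v axis i 1 = ws ! idx i" using cols[OF ws] len by auto
  have "invertible A" using A(1) by (simp add: invertible_det_nz)
  then obtain A' where A': "A ** A' = mat 1" "A' ** A = mat 1" by (auto simp: invertible_def)
  have "det A * det A' = 1" using A'(1) by (metis det_I det_mul)
  then have "det (B ** A') = 1" using A(1) B(1) by (simp add: det_mul)
  moreover have "map ((*v) (B ** A')) vs = ws"
  proof (rule nth_equalityI)
    fix i assume "i < length (map ((*v) (B ** A')) vs)"
    then have i: "i < ?r" by simp
    then have eI: "e i \<in> I" by (simp add: I_def)
    have "(B ** A') *v (vs ! i) = B *v (A' *v (A *v axis (e i) 1))"
      using A(2)[OF eI] idx[OF i] by (simp add: matrix_vector_mul_assoc)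
    also have "\<dots> = ws ! i"
      using A'(2) B(2)[OF eI] idx[OF i] by (simp add: matrix_vector_mul_assoc)
    finally show "map ((*v) (B ** A')) vs ! i = ws ! i" using i by simp
  qed (use len in simp)
  ultimately show ?thesis unfolding SL_def by blast
qed

lemma SL_GammaL: "SL \<subseteq> GammaL"
proof
  fix f :: "'k::field ^ 'n::finite \<Rightarrow> 'k ^ 'n" assume "f \<in> SL"
  then obtain A :: "'k ^ 'n ^ 'n" where A: "det A = 1" "f = (*v) A" by (auto simp: SL_def)
  have "invertible A" using A(1) by (simp add: invertible_det_nz)
  then have "bij f" using A(2) invertible_eq_bij by blast
  moreover have "field_automorphism (\<lambda>x::'k. x)" by (simp add: field_automorphism_def bij_id[unfolded id_def])
  moreover have "semilinear (\<lambda>x. x) f"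
    by (simp add: semilinear_def A(2) matrix_vector_right_distrib vector_scalar_commute)
  ultimately show "f \<in> GammaL" unfolding GammaL_def by blast
qed

section \<open>Lines of projective space\<close>

lemma proj_line_extend:
  assumes U: "U \<in> proj_lines" and a: "a \<in> U" "a \<noteq> 0"
  obtains b where "a \<noteq> b" "vec.independent {a, b}" "U = vec.span {a, b}"
proof -
  have U': "vec.subspace U" "vec.dim U = 2" using U by (auto simp: proj_lines_def)
  have "\<not> U \<subseteq> vec.span {a}"
    using vec.dim_le_card[of U "{a}"] U'(2) by auto
  then obtain b where b: "b \<in> U" "b \<notin> vec.span {a}" by blast
  have "a \<noteq> b" using b(2) vec.span_base[of a "{a}"] by auto
  have indep: "vec.independent {a, b}"
    using b(2) a(2) by (simp add: insert_commute[of a b] vec.independent_insert)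
  have "vec.span {a, b} \<subseteq> U" using U'(1) a(1) b(1) by (intro vec.span_minimal) auto
  moreover have "vec.dim (vec.span {a, b}) = 2"
    using vec.dim_span_eq_card_independent[OF indep] \<open>a \<noteq> b\<close> by simp
  ultimately have "vec.span {a, b} = U"
    using U' by (intro vec.subspace_dim_equal) simp_all
  then show thesis using that \<open>a \<noteq> b\<close> indep by blast
qed

lemma proj_line_nonzero:
  fixes U :: "('a::field ^ 'b::finite) set"
  assumes "U \<in> proj_lines"
  obtains a where "a \<in> U" "a \<noteq> 0"
proof -
  have "\<not> U \<subseteq> vec.span {}"
  proof
    assume "U \<subseteq> vec.span {}"
    then have "vec.dim U \<le> card ({} :: ('a ^ 'b) set)" by (rule vec.dim_le_card) simp
    moreover have "vec.dim U = 2" using assms by (simp add: proj_lines_def)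
    ultimately show False by (simp only: card.empty)
  qed
  then show thesis using that by auto
qed

text \<open>This is adjacency in the Grassmann graph of lines. As lines are subspaces, sharing a
  projective point means having a common nonzero vector.\<close>

definition lines_meet :: "('k::field ^ 'n::finite) set \<Rightarrow> ('k ^ 'n) set \<Rightarrow> bool" where
  "lines_meet U W \<longleftrightarrow> U \<noteq> W \<and> \<not> U \<inter> W \<subseteq> {0}"

text \<open>Bases adapted to a pair of lines turn transitivity on pairs of lines into transitivity
  on lists of independent vectors; here \<open>a\<close> spans the common point.\<close>

lemma meeting_lines_basis:
  assumes U: "U \<in> proj_lines" and W: "W \<in> proj_lines" and "lines_meet U W"
  obtains a b c where "distinct [a, b, c]" "vec.independent (set [a, b, c])"
    "U = vec.span {a, b}" "W = vec.span {a, c}"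
proof -
  obtain a where a: "a \<in> U" "a \<in> W" "a \<noteq> 0" using \<open>lines_meet U W\<close> by (auto simp: lines_meet_def)
  obtain b where b: "a \<noteq> b" "vec.independent {a, b}" "U = vec.span {a, b}"
    using proj_line_extend[OF U a(1,3)] by blast
  obtain c where c: "a \<noteq> c" "vec.independent {a, c}" "W = vec.span {a, c}"
    using proj_line_extend[OF W a(2,3)] by blast
  have "c \<notin> U"
  proof
    assume "c \<in> U"
    then have "W \<subseteq> U"
      unfolding c(3) using a(1) U by (intro vec.span_minimal) (simp_all add: proj_lines_def)
    moreover have "vec.subspace W" "vec.subspace U" "vec.dim U \<le> vec.dim W"
      using U W by (simp_all add: proj_lines_def)
    ultimately have "W = U" by (intro vec.subspace_dim_equal)
    then show False using \<open>lines_meet U W\<close> by (simp add: lines_meet_def)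
  qed
  then have "c \<notin> vec.span {a, b}" using b(3) by simp
  moreover from this have "b \<noteq> c" using vec.span_base[of b "{a, b}"] by auto
  moreover have "vec.independent (insert c {a, b})"
    using calculation(1) b(2) by (rule vec.independent_insertI)
  ultimately show thesis using that[of a b c] b c by (simp add: insert_commute)
qed

lemma skew_lines_basis:
  assumes U: "U \<in> proj_lines" and W: "W \<in> proj_lines" and skew: "U \<inter> W \<subseteq> {0}"
  obtains a b c d where "distinct [a, b, c, d]" "vec.independent (set [a, b, c, d])"
    "U = vec.span {a, b}" "W = vec.span {c, d}"
proof -
  have U': "vec.subspace U" and W': "vec.subspace W" using U W by (auto simp: proj_lines_def)
  obtain a where a: "a \<in> U" "a \<noteq> 0" using proj_line_nonzero[OF U] by blast
  obtain b where b: "a \<noteq> b" "vec.independent {a, b}" "U = vec.span {a, b}"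
    using proj_line_extend[OF U a] by blast
  obtain c where c: "c \<in> W" "c \<noteq> 0" using proj_line_nonzero[OF W] by blast
  obtain d where d: "c \<noteq> d" "vec.independent {c, d}" "W = vec.span {c, d}"
    using proj_line_extend[OF W c] by blast
  have dW: "d \<in> W" using d(3) vec.span_base[of d "{c, d}"] by simp
  have cU: "c \<notin> vec.span {a, b}" using c skew b(3) by auto
  \<comment> \<open>A dependence would put some \<open>d - k *s c\<close> into both lines, hence
    make it zero, although \<open>c\<close> and \<open>d\<close> are independent.\<close>
  have "d \<notin> vec.span (insert c {a, b})"
  proof
    assume "d \<in> vec.span (insert c {a, b})"
    then obtain k where "d - k *s c \<in> U" unfolding b(3) by (auto simp: vec.span_breakdown_eq)
    moreover have "d - k *s c \<in> W"
      using dW c(1) W' by (intro vec.subspace_diff vec.subspace_scale)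
    ultimately have "d - k *s c = 0" using skew by blast
    then have "d \<in> vec.span {c}" by (simp add: vec.span_scale vec.span_base)
    then show False using d(1,2) by (simp add: insert_commute[of c d] vec.independent_insert)
  qed
  then have "vec.independent (insert d (insert c {a, b}))" "d \<noteq> a" "d \<noteq> b"
    using vec.independent_insertI[OF _ vec.independent_insertI[OF cU b(2)]]
      vec.span_base[of d "insert c {a, b}"] by auto
  moreover have "c \<noteq> a" "c \<noteq> b" using cU vec.span_base[of c "{a, b}"] by auto
  ultimately show thesis using that[of a b c d] b d by (simp add: insert_commute)
qed

text \<open>Coordinate lines provide the explicit three-line paths: whether two of them meet can be
  read off from their index pairs.\<close>

lemma axis_line:
  fixes i j :: "'n::finite"
  assumes "i \<noteq> j"
  defines "L \<equiv> vec.span {axis i (1::'k::field), axis j 1}"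
  shows "L \<in> proj_lines" "axis i 1 \<in> L" "axis j 1 \<in> L"
    "\<And>x k. x \<in> L \<Longrightarrow> k \<noteq> i \<Longrightarrow> k \<noteq> j \<Longrightarrow> x $ k = 0"
proof -
  have "vec.independent {axis i (1::'k), axis j 1}"
    by (rule vec.independent_mono[OF independent_cart_basis]) (auto simp: cart_basis_def)
  moreover have "axis i (1::'k) \<noteq> axis j 1" using assms by (simp add: axis_eq_axis)
  ultimately show "L \<in> proj_lines"
    by (simp add: proj_lines_def L_def vec.dim_eq_card_independent)
  show "axis i 1 \<in> L" "axis j 1 \<in> L" by (simp_all add: L_def vec.span_base)
  show "x $ k = 0" if "x \<in> L" "k \<noteq> i" "k \<noteq> j" for x k
    using that(1) unfolding L_def
    by (induction rule: vec.span_induct_alt) (use that in \<open>auto simp: axis_def\<close>)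
qed

lemma five_indices:
  assumes "CARD('n::finite) \<ge> 5"
  obtains i1 i2 i3 i4 i5 :: "'n::finite" where "distinct [i1, i2, i3, i4, i5]"
proof -
  obtain xs :: "'n list" where xs: "set xs = UNIV" "distinct xs"
    using finite_distinct_list[of "UNIV :: 'n set"] by auto
  then have "length xs \<ge> 5" using assms distinct_card[of xs] by simp
  then obtain i1 i2 i3 i4 i5 ys where "xs = i1 # i2 # i3 # i4 # i5 # ys"
    by (auto simp: numeral_eq_Suc Suc_le_length_iff)
  then show thesis using that[of i1 i2 i3 i4 i5] xs(2) by simp
qed

text \<open>The lower bound \<open>PSL\<close> on \<open>G\<close> supplies all the transitivity,
  and the upper bound \<open>PGammaL\<close> supplies the invariance of
  \<open>lines_meet\<close>.\<close>

theorem lines_almost_synchronizing: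
  fixes G :: "(('k::{field,finite} ^ 'n::finite) set \<Rightarrow> ('k ^ 'n) set) set"
  assumes n: "CARD('n) \<ge> 5"
    and G: "subgroup G (BijGroup subspaces)" "PSL \<subseteq> G" "G \<subseteq> PGammaL"
  shows "almost_synchronizing proj_lines (action_on proj_lines G)"
proof -
  let ?H = "action_on proj_lines G"
  have G_apply: "\<exists>f\<in>GammaL. \<forall>U\<in>proj_lines. g U = f ` U" if g: "g \<in> G" for g
  proof -
    obtain f where "f \<in> GammaL" "g = proj_map f" using g G(3) by (auto simp: PGammaL_def)
    then show ?thesis using GammaL_proj_map proj_lines_subspaces by blast
  qed
  have SL_apply: "\<exists>h\<in>?H. \<forall>U\<in>proj_lines. h U = f ` U" if f: "f \<in> SL" for f
  proof
    show "restrict (proj_map f) proj_lines \<in> ?H"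
      using f G(2) by (auto simp: PSL_def action_on_def)
    show "\<forall>U\<in>proj_lines. restrict (proj_map f) proj_lines U = f ` U"
      using proj_lines_subspaces by (auto simp: proj_map_def)
  qed
  have transitive_span: "\<exists>h\<in>?H. \<exists>f. map f vs = ws \<and> (\<forall>S. vec.span S \<in> proj_lines \<longrightarrow> h (vec.span S) = vec.span (f ` S))"
    if lists: "distinct vs" "vec.independent (set vs)" "distinct ws" "vec.independent (set ws)"
      "length vs = length ws" "length vs < CARD('n)" for vs ws :: "('k ^ 'n) list"
  proof -
    obtain f where f: "f \<in> SL" "map f vs = ws" using SL_transitive_lists[OF lists] by blast
    obtain h where h: "h \<in> ?H" "\<forall>U\<in>proj_lines. h U = f ` U" using SL_apply[OF f(1)] by blast
    have "f \<in> GammaL" using f SL_GammaL by blast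
    then have "\<forall>S. vec.span S \<in> proj_lines \<longrightarrow> h (vec.span S) = vec.span (f ` S)"
      using h(2) by (simp add: GammaL_span)
    then show ?thesis using h(1) f(2) by blast
  qed
  obtain i1 i2 i3 i4 i5 :: 'n where i: "distinct [i1, i2, i3, i4, i5]" using five_indices[OF n] by blast
  define L where "L i j = vec.span {axis i (1::'k), axis j 1}" for i j :: 'n
  have L: "L i j \<in> proj_lines" "axis i 1 \<in> L i j" "axis j 1 \<in> L i j"
    "\<And>x k. x \<in> L i j \<Longrightarrow> k \<noteq> i \<Longrightarrow> k \<noteq> j \<Longrightarrow> x $ k = 0" if "i \<noteq> j" for i j
    using axis_line[OF that, where 'k = 'k] unfolding L_def by blast+
  have L_meet: "lines_meet (L i j) (L i' j')"
    if "i \<noteq> j" "i' \<noteq> j'" "l \<in> {i, j} \<inter> {i', j'}" "m \<in> {i, j}" "m \<notin> {i', j'}" for i j i' j' l m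
  proof -
    have "axis l (1::'k) \<in> L i j \<inter> L i' j'" using that L by auto
    moreover have "axis l (1::'k) \<noteq> 0" by (simp add: axis_eq_0_iff)
    moreover have "axis m (1::'k) \<in> L i j" using that L by auto
    moreover have "axis m (1::'k) \<notin> L i' j'" using that L(4)[OF that(2), of "axis m 1" m] by auto
    ultimately show ?thesis unfolding lines_meet_def by blast
  qed
  have L_skew: "L i j \<inter> L i' j' \<subseteq> {0}" if "i \<noteq> j" "i' \<noteq> j'" "{i, j} \<inter> {i', j'} = {}" for i j i' j'
  proof
    fix x assume "x \<in> L i j \<inter> L i' j'"
    then have "x $ k = 0" for k
      using L(4)[OF that(1), of x k] L(4)[OF that(2), of x k] that(3) by auto
    then show "x \<in> {0}" by (simp add: vec_eq_iff)
  qed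
  have L_neq: "L i j \<noteq> L i' j'" if "i \<noteq> j" "i' \<noteq> j'" "L i j \<inter> L i' j' \<subseteq> {0}" for i j i' j'
    using that L(2)[OF that(1)] by (auto simp: axis_eq_0_iff)
  have "rank3_group proj_lines ?H lines_meet"
  proof (rule rank3_group.intro)
    show "finite (proj_lines :: ('k ^ 'n) set set)" by simp
    show "subgroup ?H (BijGroup proj_lines)"
    proof (rule action_on_subgroup[OF G(1) proj_lines_subspaces])
      show "g ` proj_lines \<subseteq> proj_lines" if "g \<in> G" for g
        using G_apply[OF that] GammaL_proj_lines by auto
    qed simp
    show "lines_meet W U" if "lines_meet U W" for U W :: "('k ^ 'n) set"
      using that by (auto simp: lines_meet_def)
    show "\<not> lines_meet U U" for U :: "('k ^ 'n) set" by (simp add: lines_meet_def)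
    show "lines_meet (h U) (h W) \<longleftrightarrow> lines_meet U W"
      if h: "h \<in> ?H" and U: "U \<in> proj_lines" "W \<in> proj_lines" for h U W
    proof -
      obtain g where g: "g \<in> G" "h = restrict g proj_lines" using h by (auto simp: action_on_def)
      obtain f where "f \<in> GammaL" "\<forall>U\<in>proj_lines. g U = f ` U" using G_apply[OF g(1)] by blast
      then have f: "f \<in> GammaL" "h U = f ` U" "h W = f ` W" using U g(2) by simp_all
      have "f ` U \<inter> f ` W = f ` (U \<inter> W)"
        using GammaL_bij[OF f(1)] by (simp add: bij_is_inj image_Int)
      moreover have "f ` (U \<inter> W) \<subseteq> {0} \<longleftrightarrow> U \<inter> W \<subseteq> {0}"
        using GammaL_eq_0_iff[OF f(1)] by auto
      moreover have "f ` U = f ` W \<longleftrightarrow> U = W"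
        using GammaL_bij[OF f(1)] by (simp add: bij_is_inj inj_image_eq_iff)
      ultimately show ?thesis by (simp add: lines_meet_def f)
    qed
    show "\<exists>h\<in>?H. h U = W" if U: "U \<in> proj_lines" and W: "W \<in> proj_lines" for U W
    proof -
      obtain a where a: "a \<in> U" "a \<noteq> 0" using proj_line_nonzero[OF U] by blast
      obtain b where b: "a \<noteq> b" "vec.independent {a, b}" "U = vec.span {a, b}"
        using proj_line_extend[OF U a] by blast
      obtain c where c: "c \<in> W" "c \<noteq> 0" using proj_line_nonzero[OF W] by blast
      obtain d where d: "c \<noteq> d" "vec.independent {c, d}" "W = vec.span {c, d}"
        using proj_line_extend[OF W c] by blast
      obtain h f where "h \<in> ?H" "map f [a, b] = [c, d]"
        "\<forall>S. vec.span S \<in> proj_lines \<longrightarrow> h (vec.span S) = vec.span (f ` S)"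
        using transitive_span[of "[a, b]" "[c, d]"] b d n by auto
      then have "h U = W" using U by (simp add: b(3) d(3))
      then show ?thesis using \<open>h \<in> ?H\<close> by blast
    qed
    show "\<exists>h\<in>?H. h U = U' \<and> h W = W'"
      if U: "U \<in> proj_lines" "W \<in> proj_lines" "U' \<in> proj_lines" "W' \<in> proj_lines" and m: "lines_meet U W" "lines_meet U' W'" for U W U' W'
    proof -
      obtain a b c where 1: "distinct [a, b, c]" "vec.independent (set [a, b, c])"
        "U = vec.span {a, b}" "W = vec.span {a, c}" by (rule meeting_lines_basis[OF U(1,2) m(1)])
      obtain a' b' c' where 2: "distinct [a', b', c']" "vec.independent (set [a', b', c'])"
        "U' = vec.span {a', b'}" "W' = vec.span {a', c'}" by (rule meeting_lines_basis[OF U(3,4) m(2)])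
      obtain h f where h: "h \<in> ?H" "map f [a, b, c] = [a', b', c']"
        "\<forall>S. vec.span S \<in> proj_lines \<longrightarrow> h (vec.span S) = vec.span (f ` S)"
        using transitive_span[OF 1(1,2) 2(1,2)] n by auto
      have "h U = U'" "h W = W'" using h(2,3) U by (simp_all add: 1(3,4) 2(3,4))
      then show ?thesis using h(1) by blast
    qed
    show "\<exists>h\<in>?H. h U = U' \<and> h W = W'"
      if U: "U \<in> proj_lines" "W \<in> proj_lines" "U' \<in> proj_lines" "W' \<in> proj_lines"
        and m: "U \<noteq> W" "\<not> lines_meet U W" "U' \<noteq> W'" "\<not> lines_meet U' W'" for U W U' W'
    proof -
      have s: "U \<inter> W \<subseteq> {0}" "U' \<inter> W' \<subseteq> {0}" using m by (auto simp: lines_meet_def)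
      obtain a b c d where 1: "distinct [a, b, c, d]" "vec.independent (set [a, b, c, d])"
        "U = vec.span {a, b}" "W = vec.span {c, d}" by (rule skew_lines_basis[OF U(1,2) s(1)])
      obtain a' b' c' d' where 2: "distinct [a', b', c', d']" "vec.independent (set [a', b', c', d'])"
        "U' = vec.span {a', b'}" "W' = vec.span {c', d'}" by (rule skew_lines_basis[OF U(3,4) s(2)])
      obtain h f where h: "h \<in> ?H" "map f [a, b, c, d] = [a', b', c', d']"
        "\<forall>S. vec.span S \<in> proj_lines \<longrightarrow> h (vec.span S) = vec.span (f ` S)"
        using transitive_span[OF 1(1,2) 2(1,2)] n by auto
      have "h U = U'" "h W = W'" using h(2,3) U by (simp_all add: 1(3,4) 2(3,4))
      then show ?thesis using h(1) by blast
    qed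
    \<comment> \<open>Consecutive index pairs 12, 23, 34 share an index, while 12 and 34 are
      disjoint.\<close>
    have "lines_meet (L i1 i2) (L i2 i3)" "lines_meet (L i2 i3) (L i3 i4)"
      using i L_meet[of i1 i2 i2 i3 i2 i1] L_meet[of i2 i3 i3 i4 i3 i2] by auto
    moreover have skew: "L i1 i2 \<inter> L i3 i4 \<subseteq> {0}"
      using i by (intro L_skew) auto
    moreover have "L i1 i2 \<noteq> L i3 i4" using i skew by (intro L_neq) auto
    moreover have "L i1 i2 \<in> proj_lines" "L i2 i3 \<in> proj_lines" "L i3 i4 \<in> proj_lines" "L i1 i5 \<in> proj_lines"
      using i by (auto intro!: L(1))
    ultimately show "\<exists>U\<in>proj_lines. \<exists>W\<in>proj_lines. \<exists>Y\<in>proj_lines. lines_meet U W \<and> lines_meet W Y \<and> U \<noteq> (Y :: ('k ^ 'n) set) \<and> \<not> lines_meet U Y"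
      unfolding lines_meet_def by blast
    \<comment> \<open>The complementary path is 12, 34, 15: the middle line is skew to both ends,
      which meet in the first coordinate point. The fifth index lets 15 avoid 34 and still differ
      from 12.\<close>
    have "lines_meet (L i1 i2) (L i1 i5)" using i L_meet[of i1 i2 i1 i5 i1 i2] by auto
    moreover have skew': "L i3 i4 \<inter> L i1 i5 \<subseteq> {0}" using i by (intro L_skew) auto
    moreover have "L i3 i4 \<noteq> L i1 i5" using i skew' by (intro L_neq) auto
    ultimately show "\<exists>U\<in>proj_lines. \<exists>W\<in>proj_lines. \<exists>Y\<in>proj_lines. U \<noteq> W \<and> W \<noteq> Y \<and> \<not> lines_meet U W \<and> \<not> lines_meet W Y \<and> lines_meet U (Y :: ('k ^ 'n) set)"
      using skew \<open>L i1 i2 \<noteq> L i3 i4\<close> \<open>L i1 i2 \<in> _\<close> \<open>L i3 i4 \<in> _\<close> \<open>L i1 i5 \<in> _\<close> unfolding lines_meet_def by blast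
  qed
  then show ?thesis by (rule rank3_group.almost_synchronizing)
qed

section \<open>Points of the symplectic quadrangle\<close>

locale symplectic_space4 =
  fixes B :: "'h::{field,finite} ^ 4 \<Rightarrow> 'h ^ 4 \<Rightarrow> 'h"
  assumes form: "symplectic_form B"
begin

section \<open>Coordinates and isometries in a symplectic space\<close>

lemma B_add_right: "B x (y + z) = B x y + B x z"
  and B_scale_right: "B x (c *s y) = c * B x y"
  and B_add_left: "B (x + y) z = B x z + B y z"
  and B_scale_left: "B (c *s x) y = c * B x y"
  and B_self: "B x x = 0"
  using form by (simp_all add: symplectic_form_def Vector_Spaces.linear_iff)

lemma B_nondegenerate: "(\<And>y. B x y = 0) \<Longrightarrow> x = 0"
  using form by (simp add: symplectic_form_def)

lemma B_zero_right: "B x 0 = 0" and B_zero_left: "B 0 x = 0"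
  using B_scale_right[of x 0 0] B_scale_left[of 0 0 x] by simp_all

lemma B_minus_right: "B x (- y) = - B x y" and B_minus_left: "B (- x) y = - B x y"
  using B_scale_right[of x "- 1" y] B_scale_left[of "- 1" x y] by simp_all

lemma B_diff_right: "B x (y - z) = B x y - B x z" and B_diff_left: "B (x - y) z = B x z - B y z"
  using B_add_right[of x y "- z"] B_add_left[of x "- y" z] by (simp_all add: B_minus_right B_minus_left)

lemma B_skew: "B y x = - B x y"
proof -
  have "B (x + y) (x + y) = B y x + B x y"
    unfolding B_add_right B_add_left by (simp add: B_self)
  then have "B y x + B x y = 0" by (simp add: B_self)
  then show ?thesis by (simp only: eq_neg_iff_add_eq_0)
qed

lemmas B_simps = B_add_right B_scale_right B_add_left B_scale_left B_self B_diff_right B_diff_left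

lemma form_combination:
  assumes "symplectic_basis4 B a1 a2 b1 b2"
  shows "B (p1 *s a1 + p2 *s a2 + q1 *s b1 + q2 *s b2) (r1 *s a1 + r2 *s a2 + s1 *s b1 + s2 *s b2)
    = p1 * s1 + p2 * s2 - q1 * r1 - q2 * r2"
  using assms B_skew[of a2 a1] B_skew[of b1 a1] B_skew[of b2 a1] B_skew[of b1 a2] B_skew[of b2 a2] B_skew[of b2 b1]
  by (simp add: symplectic_basis4_def B_simps algebra_simps)

text \<open>Pairing with the basis vectors recovers the four coefficients, so \<open>F\<close> is
  injective; over a finite field an injective self-map of the space is onto, which yields spanning
  without a dimension argument.\<close>

lemma basis_expansion:
  assumes sb: "symplectic_basis4 B a1 a2 b1 b2"
  shows "x = B x b1 *s a1 + B x b2 *s a2 + B a1 x *s b1 + B a2 x *s b2"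
proof -
  define F where "F c = c $ 1 *s a1 + c $ 2 *s a2 + c $ 3 *s b1 + c $ 4 *s b2" for c :: "'h ^ 4"
  have F: "B (F c) b1 = c $ 1" "B (F c) b2 = c $ 2" "B a1 (F c) = c $ 3" "B a2 (F c) = c $ 4" for c
    using form_combination[OF sb, of "c $ 1" "c $ 2" "c $ 3" "c $ 4" 0 0 1 0]
      form_combination[OF sb, of "c $ 1" "c $ 2" "c $ 3" "c $ 4" 0 0 0 1]
      form_combination[OF sb, of 1 0 0 0 "c $ 1" "c $ 2" "c $ 3" "c $ 4"]
      form_combination[OF sb, of 0 1 0 0 "c $ 1" "c $ 2" "c $ 3" "c $ 4"]
    by (simp_all add: F_def)
  have "inj F"
  proof (rule injI)
    fix c d assume "F c = F d"
    then have "c $ i = d $ i" if "i \<in> {1, 2, 3, 4}" for i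
      using F[of c] F[of d] that by auto
    then show "c = d" by (simp add: vec_eq_iff forall_4)
  qed
  then have "surj F" by (rule finite_UNIV_inj_surj[OF finite])
  then obtain c where "x = F c" by blast
  then show ?thesis using F[of c] by (simp add: F_def)
qed

lemma form_coordinates:
  assumes sb: "symplectic_basis4 B a1 a2 b1 b2"
  shows "B x y = B x b1 * B a1 y + B x b2 * B a2 y - B a1 x * B y b1 - B a2 x * B y b2"
  using form_combination[OF sb, of "B x b1" "B x b2" "B a1 x" "B a2 x" "B y b1" "B y b2" "B a1 y" "B a2 y"]
  by (simp flip: basis_expansion[OF sb])

text \<open>The map reads coordinates in the first basis and reuses them in the second. It is an
  isometry because both bases have the same Gram matrix, and injective because the form is
  nondegenerate.\<close>

lemma Sp_transitive_bases:
  assumes sb: "symplectic_basis4 B a1 a2 b1 b2" and sb': "symplectic_basis4 B a1' a2' b1' b2'"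
  shows "\<exists>f\<in>Sp B. f a1 = a1' \<and> f a2 = a2' \<and> f b1 = b1' \<and> f b2 = b2'"
proof -
  define f where "f x = B x b1 *s a1' + B x b2 *s a2' + B a1 x *s b1' + B a2 x *s b2'" for x
  have add: "f (x + y) = f x + f y" for x y
    by (simp add: f_def B_simps vector_sadd_rdistrib)
  have scale: "f (c *s x) = c *s f x" for c x
    by (simp add: f_def B_simps vector_add_ldistrib vector_smult_assoc)
  have isometry: "B (f x) (f y) = B x y" for x y
    unfolding f_def form_combination[OF sb'] by (rule form_coordinates[OF sb, symmetric])
  have "inj f"
  proof (rule injI)
    fix x y assume eq: "f x = f y"
    have "B (x - y) z = 0" for z
      using isometry[of x z] isometry[of y z] by (simp add: B_simps eq)
    then show "x = y" using B_nondegenerate by (metis eq_iff_diff_eq_0)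
  qed
  then have "bij f" by (simp add: bij_def finite_UNIV_inj_surj)
  moreover have "Vector_Spaces.linear (*s) (*s) f"
    using add scale by (simp add: Vector_Spaces.linear_iff vec.vector_space_axioms)
  moreover have "f a1 = a1'" "f a2 = a2'" "f b1 = b1'" "f b2 = b2'"
    using sb B_skew[of b1 b2] B_skew[of a2 a1] unfolding f_def symplectic_basis4_def by (simp_all add: B_self)
  ultimately show ?thesis using isometry unfolding Sp_def by blast
qed

lemma extend_hyperbolic_pair:
  assumes uw: "B u w = 1"
  obtains a b where "symplectic_basis4 B u a w b"
proof -
  \<comment> \<open>\<open>\<pi>\<close> is the orthogonal projection that removes the hyperbolic
    plane spanned by \<open>u\<close> and \<open>w\<close>. A hyperbolic pair is sought in its
    image.\<close>
  define \<pi> where "\<pi> x = x - B x w *s u - B u x *s w" for x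
  have proj: "B u (\<pi> x) = 0" "B (\<pi> x) w = 0" "B (\<pi> x) u = 0" "B w (\<pi> x) = 0" for x
    using uw B_skew[of u x] B_skew[of w u] B_skew[of w x]
    by (simp_all add: \<pi>_def B_simps)
  have "\<exists>x y. B (\<pi> x) (\<pi> y) \<noteq> 0"
  proof (rule ccontr)
    assume "\<not> ?thesis"
    then have zero: "B (\<pi> x) (\<pi> y) = 0" for x y by blast
    \<comment> \<open>As \<open>\<pi> x\<close> is orthogonal to the plane, replacing
      \<open>y\<close> by \<open>\<pi> y\<close> does not change the pairing. If all these pairings
      vanish, nondegeneracy makes \<open>\<pi>\<close> zero, and the plane would be the whole
      4-dimensional space.\<close>
    have "B (\<pi> x) y = 0" for x y
    proof -
      have "B (\<pi> x) (\<pi> y) = B (\<pi> x) y"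
        unfolding \<pi>_def[of y] by (simp add: B_simps proj)
      then show ?thesis using zero by simp
    qed
    then have "\<pi> x = 0" for x using B_nondegenerate by blast
    then have eq: "x = B x w *s u + B u x *s w" for x
      unfolding \<pi>_def diff_diff_eq right_minus_eq .
    have "x \<in> vec.span {u, w}" for x
      by (subst eq) (simp add: vec.span_add vec.span_scale vec.span_base)
    then have "vec.dim (UNIV :: ('h ^ 4) set) \<le> card {u, w}"
      by (intro vec.dim_le_card) auto
    also have "\<dots> \<le> 2" by (simp add: card_insert_if)
    finally show False by (simp only: vec_dim_card) simp
  qed
  then obtain x y where xy: "B (\<pi> x) (\<pi> y) \<noteq> 0" by blast
  have "symplectic_basis4 B u (\<pi> x) w (inverse (B (\<pi> x) (\<pi> y)) *s \<pi> y)"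
    using xy uw proj by (simp add: symplectic_basis4_def B_simps)
  then show thesis by (rule that)
qed

text \<open>If the functional of \<open>u\<close> vanished on the kernel of that of
  \<open>w\<close>, the two would be proportional, and by nondegeneracy so would be the
  vectors.\<close>

lemma separating_vector:
  assumes "u \<notin> vec.span {w}"
  obtains y where "B w y = 0" "B u y = 1"
proof -
  have "\<exists>y. B w y = 0 \<and> B u y \<noteq> 0"
  proof (rule ccontr)
    assume "\<not> ?thesis"
    then have zero: "B w y = 0 \<Longrightarrow> B u y = 0" for y by blast
    have "w \<noteq> 0"
      using zero B_nondegenerate[of u] assms by (auto simp: B_zero_left)
    then obtain y0 where y0: "B w y0 \<noteq> 0" using B_nondegenerate by blast
    define c where "c = B u y0 / B w y0"
    have "B (u - c *s w) y = 0" for y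
    proof -
      have "B u (y - (B w y / B w y0) *s y0) = 0" using y0 by (intro zero) (simp add: B_simps)
      then show ?thesis by (simp add: B_simps c_def)
    qed
    then have "u = c *s w" using B_nondegenerate[of "u - c *s w"] by simp
    then show False using assms by (simp add: vec.span_scale vec.span_base)
  qed
  then obtain y where y: "B w y = 0" "B u y \<noteq> 0" by blast
  then show thesis using that[of "inverse (B u y) *s y"] by (simp add: B_simps)
qed

lemma extend_orthogonal_pair:
  assumes uw: "B u w = 0" "u \<notin> vec.span {w}" "w \<notin> vec.span {u}"
  obtains a b where "symplectic_basis4 B u w a b"
proof -
  obtain a where a: "B w a = 0" "B u a = 1" using separating_vector[OF uw(2)] .
  obtain b where b: "B u b = 0" "B w b = 1" using separating_vector[OF uw(3)] .
  \<comment> \<open>Since \<open>B a u = -1\<close>, adding \<open>B a b *s u\<close> to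
    \<open>b\<close> cancels the pairing with \<open>a\<close>; the pairings with \<open>u\<close>
    and \<open>w\<close> are unaffected because \<open>u\<close> is orthogonal to both.\<close>
  have "symplectic_basis4 B u w a (b + B a b *s u)"
    using a b uw(1) B_skew[of a u] B_skew[of w u] by (simp add: symplectic_basis4_def B_simps)
  then show thesis by (rule that)
qed

lemma Sp_GammaL: "Sp B \<subseteq> GammaL"
proof
  fix f assume f: "f \<in> Sp B"
  have "field_automorphism (\<lambda>x::'h. x)" by (simp add: field_automorphism_def bij_id[unfolded id_def])
  moreover have "semilinear (\<lambda>x. x) f"
    using f by (simp add: Sp_def semilinear_def Vector_Spaces.linear_iff)
  ultimately show "f \<in> GammaL" using f unfolding GammaL_def Sp_def by blast
qed

lemma field_automorphism_zero: "field_automorphism \<sigma> \<Longrightarrow> \<sigma> (x :: 'h) = 0 \<longleftrightarrow> x = 0"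
proof -
  assume \<sigma>: "field_automorphism \<sigma>"
  then have "\<sigma> (0 + 0) = \<sigma> 0 + \<sigma> 0" unfolding field_automorphism_def by blast
  then have "\<sigma> 0 + 0 = \<sigma> 0 + \<sigma> 0" by (simp only: add_0_right)
  then have "\<sigma> 0 = 0" by (simp only: add_left_cancel)
  then show ?thesis using \<sigma> unfolding field_automorphism_def by (metis bij_is_inj injD)
qed

text \<open>In a symplectic basis the form has coefficients 0, 1 and -1, all fixed by
  \<open>\<sigma>\<close>. Hence \<open>B (f x) (f y) = \<sigma> (B x y)\<close>, so the form itself
  need not be preserved, but orthogonality is.\<close>

lemma field_aut_maps_semisimilarity:
  assumes sb: "symplectic_basis4 B a1 a2 b1 b2" and S: "\<forall>\<sigma>\<in>S. field_automorphism \<sigma>"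
    and f: "f \<in> field_aut_maps {a1, a2, b1, b2} S"
  shows "f \<in> GammaL" "B (f x) (f y) = 0 \<longleftrightarrow> B x y = 0"
proof -
  obtain \<sigma> where \<sigma>: "field_automorphism \<sigma>" and semi: "semilinear \<sigma> f"
    and fix_basis: "f a1 = a1" "f a2 = a2" "f b1 = b1" "f b2 = b2"
    using f S by (auto simp: field_aut_maps_def)
  have \<sigma>_simps: "\<sigma> (c + d) = \<sigma> c + \<sigma> d" "\<sigma> (c * d) = \<sigma> c * \<sigma> d" for c d
    using \<sigma> by (auto simp: field_automorphism_def)
  have \<sigma>_diff: "\<sigma> (c - d) = \<sigma> c - \<sigma> d" for c d
    using \<sigma>_simps(1)[of "c - d" d] by simp
  have f_eq: "f x = \<sigma> (B x b1) *s a1 + \<sigma> (B x b2) *s a2 + \<sigma> (B a1 x) *s b1 + \<sigma> (B a2 x) *s b2" for x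
  proof -
    have "f x = f (B x b1 *s a1 + B x b2 *s a2 + B a1 x *s b1 + B a2 x *s b2)"
      by (simp flip: basis_expansion[OF sb])
    then show ?thesis using semi by (simp add: semilinear_def fix_basis)
  qed
  have B_f: "B (f x) (f y) = \<sigma> (B x y)" for x y
    unfolding f_eq form_combination[OF sb] form_coordinates[OF sb, of x y]
    by (simp add: \<sigma>_simps \<sigma>_diff)
  then show "B (f x) (f y) = 0 \<longleftrightarrow> B x y = 0"
    by (simp add: field_automorphism_zero[OF \<sigma>])
  have "inj f"
  proof (rule injI)
    fix x y assume eq: "f x = f y"
    have "B (x - y) z = 0" for z
    proof -
      have "f (x - y) + f y = f x" using semi by (metis diff_add_cancel semilinear_def)
      then have "f (x - y) = 0" using eq by simp
      then have "\<sigma> (B (x - y) z) = 0" using B_f[of "x - y" z] by (simp add: B_zero_left)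
      then show ?thesis by (simp add: field_automorphism_zero[OF \<sigma>])
    qed
    then show "x = y" using B_nondegenerate by (metis eq_iff_diff_eq_0)
  qed
  then have "bij f" by (simp add: bij_def finite_UNIV_inj_surj)
  then show "f \<in> GammaL" using \<sigma> semi unfolding GammaL_def by blast
qed

section \<open>Orthogonality of projective points\<close>

definition perp :: "('h ^ 4) set \<Rightarrow> ('h ^ 4) set \<Rightarrow> bool" where
  "perp U W \<longleftrightarrow> (\<forall>u\<in>U. \<forall>w\<in>W. B u w = 0)"

lemma perp_sym: "perp U W \<Longrightarrow> perp W U"
  unfolding perp_def using B_skew by (metis neg_equal_0_iff_equal)

lemma perp_span: "perp (vec.span {u}) (vec.span {w}) \<longleftrightarrow> B u w = 0"
proof
  assume "perp (vec.span {u}) (vec.span {w})"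
  then show "B u w = 0" by (simp add: perp_def vec.span_base)
qed (auto simp: perp_def vec.span_singleton B_simps)

lemma proj_pointE:
  assumes "U \<in> proj_points"
  obtains u :: "'h ^ 4" where "u \<noteq> 0" "U = vec.span {u}"
proof -
  obtain b where b: "b \<subseteq> U" "vec.independent b" "U \<subseteq> vec.span b" "card b = vec.dim U"
    by (rule vec.basis_exists)
  then obtain u where u: "b = {u}" using assms by (auto simp: proj_points_def card_1_singleton_iff)
  have "vec.span b \<subseteq> U" using b(1) assms by (intro vec.span_minimal) (simp_all add: proj_points_def)
  then show thesis using that[of u] b u by (simp add: subset_antisym)
qed

lemma span_proj_point: "u \<noteq> 0 \<Longrightarrow> vec.span {u :: 'h ^ 4} \<in> proj_points"
  using vec.dim_span_eq_card_independent[of "{u}"] by (simp add: proj_points_def)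

text \<open>It suffices to examine generators, since the permutations of subspaces that keep points
  among points and respect \<open>perp\<close> in both directions form a subgroup \<open>H\<close>.
  For its inverses, finiteness ensures that an element permutes the points.\<close>

lemma PSp_adjoin_perp:
  assumes sb: "symplectic_basis4 B e1 e2 f1 f2" and S: "\<forall>\<sigma>\<in>S. field_automorphism \<sigma>"
  shows "subgroup (PSp_adjoin B {e1, e2, f1, f2} S) (BijGroup subspaces)"
    and "\<And>g U. g \<in> PSp_adjoin B {e1, e2, f1, f2} S \<Longrightarrow> U \<in> proj_points \<Longrightarrow> g U \<in> proj_points"
    and "\<And>g U W. g \<in> PSp_adjoin B {e1, e2, f1, f2} S \<Longrightarrow> U \<in> proj_points \<Longrightarrow> W \<in> proj_points \<Longrightarrow>
           perp (g U) (g W) \<longleftrightarrow> perp U W"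
proof -
  let ?G = "BijGroup (subspaces :: ('h ^ 4) set set)"
  let ?K = "PSp B \<union> proj_map ` field_aut_maps {e1, e2, f1, f2} S"
  interpret G: group ?G by (rule group_BijGroup)
  define H where "H = {g \<in> carrier ?G. (\<forall>U\<in>proj_points. g U \<in> proj_points) \<and>
      (\<forall>U\<in>proj_points. \<forall>W\<in>proj_points. perp (g U) (g W) \<longleftrightarrow> perp U W)}"
  have points: "U \<in> subspaces" if "U \<in> proj_points" for U :: "('h ^ 4) set"
    using that proj_points_subspaces by blast
  have mult: "(g \<otimes>\<^bsub>?G\<^esub> h) U = g (h U)" if "g \<in> carrier ?G" "h \<in> carrier ?G" "U \<in> proj_points" for g h U
    using that points by (simp add: BijGroup_def compose_def)
  have one: "\<one>\<^bsub>?G\<^esub> U = U" if "U \<in> proj_points" for U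
    using points[OF that] by (simp add: BijGroup_def)
  have H: "subgroup H ?G"
  proof (rule G.subgroupI)
    show "H \<subseteq> carrier ?G" by (auto simp: H_def)
    have "\<one>\<^bsub>?G\<^esub> \<in> H" using one by (simp add: H_def)
    then show "H \<noteq> {}" by blast
    fix g assume g: "g \<in> H"
    then have gc: "g \<in> carrier ?G" by (simp add: H_def)
    have "inj_on g proj_points"
      using gc points by (auto simp: BijGroup_def Bij_def bij_betw_def intro: inj_on_subset)
    then have surj: "g ` proj_points = proj_points"
      using g by (intro endo_inj_surj) (auto simp: H_def)
    have inv: "(inv\<^bsub>?G\<^esub> g) (g U) = U" if "U \<in> proj_points" for U
      using mult[OF G.inv_closed[OF gc] gc that] one[OF that] gc by simp
    have "(inv\<^bsub>?G\<^esub> g) U \<in> proj_points" if U: "U \<in> proj_points" for U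
    proof -
      obtain U' where "U' \<in> proj_points" "U = g U'" using U surj by blast
      then show ?thesis using inv by simp
    qed
    moreover have "perp ((inv\<^bsub>?G\<^esub> g) U) ((inv\<^bsub>?G\<^esub> g) W) \<longleftrightarrow> perp U W"
      if U: "U \<in> proj_points" "W \<in> proj_points" for U W
    proof -
      obtain U' where U': "U' \<in> proj_points" "U = g U'" using U(1) surj by blast
      obtain W' where W': "W' \<in> proj_points" "W = g W'" using U(2) surj by blast
      have "perp (g U') (g W') \<longleftrightarrow> perp U' W'" using g U'(1) W'(1) by (simp add: H_def)
      then show ?thesis by (simp add: U' W' inv)
    qed
    ultimately show "inv\<^bsub>?G\<^esub> g \<in> H" using gc by (simp add: H_def)
    fix h assume "h \<in> H"
    then show "g \<otimes>\<^bsub>?G\<^esub> h \<in> H" using g mult by (simp add: H_def)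
  qed
  have gen: "proj_map f \<in> H" if f: "f \<in> GammaL" "\<And>x y. B (f x) (f y) = 0 \<longleftrightarrow> B x y = 0" for f
    using proj_map_BijGroup[OF f(1)] GammaL_proj_points[OF f(1)] points f(2)
    by (simp add: H_def proj_map_def perp_def)
  have "?K \<subseteq> H"
  proof
    fix g assume "g \<in> ?K"
    then consider f where "f \<in> Sp B" "g = proj_map f"
      | f where "f \<in> field_aut_maps {e1, e2, f1, f2} S" "g = proj_map f" by (auto simp: PSp_def)
    then show "g \<in> H"
    proof cases
      case 1
      have "f \<in> GammaL" using 1(1) Sp_GammaL by blast
      moreover have "B (f x) (f y) = B x y" for x y using 1(1) by (simp add: Sp_def)
      ultimately show ?thesis using gen 1(2) by simp
    next
      case 2
      then show ?thesis using gen field_aut_maps_semisimilarity[OF sb S 2(1)] by blast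
    qed
  qed
  then have sub: "PSp_adjoin B {e1, e2, f1, f2} S \<subseteq> H"
    unfolding PSp_adjoin_def using H by (rule G.generate_subgroup_incl)
  have "?K \<subseteq> carrier ?G" using \<open>?K \<subseteq> H\<close> by (auto simp: H_def)
  then show "subgroup (PSp_adjoin B {e1, e2, f1, f2} S) ?G"
    unfolding PSp_adjoin_def by (rule G.generate_is_subgroup)
  show "g U \<in> proj_points" if "g \<in> PSp_adjoin B {e1, e2, f1, f2} S" "U \<in> proj_points" for g U
    using that sub by (auto simp: H_def)
  show "perp (g U) (g W) \<longleftrightarrow> perp U W"
    if "g \<in> PSp_adjoin B {e1, e2, f1, f2} S" "U \<in> proj_points" "W \<in> proj_points" for g U W
    using that sub by (auto simp: H_def)
qed

text \<open>\<open>PSp B\<close> supplies the transitivity, and the adjoined automorphisms only have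
  to respect \<open>perp\<close>. Distinct points are orthogonal exactly when they span a totally
  isotropic line, so \<open>R\<close> is collinearity in the quadrangle.\<close>

theorem points_almost_synchronizing:
  assumes sb: "symplectic_basis4 B e1 e2 f1 f2" and S: "\<forall>\<sigma>\<in>S. field_automorphism \<sigma>"
  shows "almost_synchronizing proj_points (action_on proj_points (PSp_adjoin B {e1, e2, f1, f2} S))"
proof -
  let ?P = "PSp_adjoin B {e1, e2, f1, f2} S"
  let ?H = "action_on proj_points ?P"
  note P = PSp_adjoin_perp[OF sb S]
  have Sp_apply: "\<exists>h\<in>?H. \<forall>u. u \<noteq> 0 \<longrightarrow> h (vec.span {u}) = vec.span {f u}" if f: "f \<in> Sp B" for f
  proof
    have "proj_map f \<in> ?P"
      using f by (auto simp: PSp_adjoin_def PSp_def intro: generate.incl)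
    then show "restrict (proj_map f) proj_points \<in> ?H" by (simp add: action_on_def)
    have "f \<in> GammaL" using f Sp_GammaL by blast
    then show "\<forall>u. u \<noteq> 0 \<longrightarrow> restrict (proj_map f) proj_points (vec.span {u}) = vec.span {f u}"
      using span_proj_point proj_points_subspaces by (auto simp: proj_map_def GammaL_span)
  qed
  have nonzero: "u \<noteq> 0" "w \<noteq> 0" if "B u w \<noteq> 0" for u w
    using that by (auto simp: B_zero_left B_zero_right)
  have hyperbolic: "\<exists>u w. B u w = 1 \<and> U = vec.span {u} \<and> W = vec.span {w}"
    if U: "U \<in> proj_points" "W \<in> proj_points" and not: "\<not> perp U W" for U W
  proof -
    obtain u where u: "u \<noteq> 0" "U = vec.span {u}" using proj_pointE[OF U(1)] .
    obtain w where w: "w \<noteq> 0" "W = vec.span {w}" using proj_pointE[OF U(2)] .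
    have uw: "B u w \<noteq> 0" using not by (simp add: u w perp_span)
    \<comment> \<open>A projective point does not fix its spanning vector, so \<open>w\<close> can
      be rescaled to make the pair hyperbolic.\<close>
    let ?w = "inverse (B u w) *s w"
    have "w = B u w *s ?w" using uw by (simp add: vector_smult_assoc)
    then have "w \<in> vec.span {?w}" by (metis vec.span_base vec.span_scale insertI1)
    then have "vec.span {w} = vec.span {?w}"
      by (intro subset_antisym vec.span_minimal) (auto intro: vec.span_scale vec.span_base)
    moreover have "B u ?w = 1" using uw by (simp add: B_simps)
    ultimately show ?thesis using u w by metis
  qed
  have transitive_not_perp: "\<exists>h\<in>?H. h U = U' \<and> h W = W'"
    if U: "U \<in> proj_points" "W \<in> proj_points" "U' \<in> proj_points" "W' \<in> proj_points"
      and not: "\<not> perp U W" "\<not> perp U' W'" for U W U' W'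
  proof -
    obtain u w where u: "B u w = 1" "U = vec.span {u}" "W = vec.span {w}"
      using hyperbolic[OF U(1,2) not(1)] by blast
    obtain u' w' where u': "B u' w' = 1" "U' = vec.span {u'}" "W' = vec.span {w'}"
      using hyperbolic[OF U(3,4) not(2)] by blast
    obtain a b where "symplectic_basis4 B u a w b" using extend_hyperbolic_pair[OF u(1)] .
    moreover obtain a' b' where "symplectic_basis4 B u' a' w' b'" using extend_hyperbolic_pair[OF u'(1)] .
    ultimately obtain f where "f \<in> Sp B" "f u = u'" "f w = w'" using Sp_transitive_bases by blast
    then show ?thesis using Sp_apply[of f] nonzero[of u w] u u' by auto
  qed
  have basis_perp: "\<exists>u w a b. symplectic_basis4 B u w a b \<and> U = vec.span {u} \<and> W = vec.span {w} \<and> u \<noteq> 0 \<and> w \<noteq> 0"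
    if U: "U \<in> proj_points" "W \<in> proj_points" and UW: "U \<noteq> W" "perp U W" for U W
  proof -
    obtain u where u: "u \<noteq> 0" "U = vec.span {u}" using proj_pointE[OF U(1)] .
    obtain w where w: "w \<noteq> 0" "W = vec.span {w}" using proj_pointE[OF U(2)] .
    have dims: "vec.subspace U" "vec.subspace W" "vec.dim U = vec.dim W"
      using U by (simp_all add: proj_points_def)
    have "u \<notin> vec.span {w}"
    proof
      assume "u \<in> vec.span {w}"
      then have "U \<subseteq> W" unfolding u w by (intro vec.span_minimal) auto
      then show False using vec.subspace_dim_equal[of U W] dims UW(1) by simp
    qed
    moreover have "w \<notin> vec.span {u}"
    proof
      assume "w \<in> vec.span {u}"
      then have "W \<subseteq> U" unfolding u w by (intro vec.span_minimal) auto
      then show False using vec.subspace_dim_equal[of W U] dims UW(1) by simp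
    qed
    moreover have "B u w = 0" using UW(2) by (simp add: u w perp_span)
    ultimately show ?thesis using extend_orthogonal_pair u w by metis
  qed
  have not_perp_ex: "\<exists>W\<in>proj_points. \<not> perp U W" if U: "U \<in> proj_points" for U
  proof -
    obtain u where u: "u \<noteq> 0" "U = vec.span {u}" using proj_pointE[OF U] .
    obtain w where "B u w \<noteq> 0" using u(1) B_nondegenerate by blast
    then show ?thesis using span_proj_point[of w] nonzero u(2) perp_span by metis
  qed
  have perp_self: "perp U U" if "U \<in> proj_points" for U
    using that by (metis B_self perp_span proj_pointE)
  define R where "R U W \<longleftrightarrow> U \<noteq> W \<and> perp U W" for U W
  have "rank3_group proj_points ?H R"
  proof (rule rank3_group.intro)
    show "finite (proj_points :: ('h ^ 4) set set)" by simp
    show H: "subgroup ?H (BijGroup proj_points)"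
      using P(2) by (intro action_on_subgroup[OF P(1) proj_points_subspaces]) auto
    show "R W U" if "R U W" for U W using that perp_sym by (auto simp: R_def)
    show "\<not> R U U" for U by (simp add: R_def)
    show "R (h U) (h W) \<longleftrightarrow> R U W" if h: "h \<in> ?H" and U: "U \<in> proj_points" "W \<in> proj_points" for h U W
    proof -
      obtain g where g: "g \<in> ?P" "h = restrict g proj_points" using h by (auto simp: action_on_def)
      have "h \<in> Bij proj_points" using subgroup.subset[OF H] h by (auto simp: BijGroup_def)
      then have "h U = h W \<longleftrightarrow> U = W" using U by (auto simp: Bij_def bij_betw_def inj_on_eq_iff)
      then show ?thesis using P(3)[OF g(1) U] U g(2) by (simp add: R_def)
    qed
    \<comment> \<open>Every point has a non-orthogonal partner, so transitivity on points is
      inherited from transitivity on non-orthogonal pairs.\<close>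
    show "\<exists>h\<in>?H. h U = U'" if U: "U \<in> proj_points" "U' \<in> proj_points" for U U'
    proof -
      obtain W where W: "W \<in> proj_points" "\<not> perp U W" using not_perp_ex[OF U(1)] by blast
      obtain W' where W': "W' \<in> proj_points" "\<not> perp U' W'" using not_perp_ex[OF U(2)] by blast
      show ?thesis using transitive_not_perp[OF U(1) W(1) U(2) W'(1) W(2) W'(2)] by blast
    qed
    show "\<exists>h\<in>?H. h U = U' \<and> h W = W'"
      if U: "U \<in> proj_points" "W \<in> proj_points" "U' \<in> proj_points" "W' \<in> proj_points"
        and R: "R U W" "R U' W'" for U W U' W'
    proof -
      obtain u w a b where u: "symplectic_basis4 B u w a b" "U = vec.span {u}" "W = vec.span {w}" "u \<noteq> 0" "w \<noteq> 0"
        using basis_perp[OF U(1,2)] R(1) by (auto simp: R_def)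
      obtain u' w' a' b' where u': "symplectic_basis4 B u' w' a' b'" "U' = vec.span {u'}" "W' = vec.span {w'}"
        using basis_perp[OF U(3,4)] R(2) by (auto simp: R_def)
      obtain f where "f \<in> Sp B" "f u = u'" "f w = w'" using Sp_transitive_bases[OF u(1) u'(1)] by blast
      then show ?thesis using Sp_apply[of f] u u' by auto
    qed
    show "\<exists>h\<in>?H. h U = U' \<and> h W = W'"
      if "U \<in> proj_points" "W \<in> proj_points" "U' \<in> proj_points" "W' \<in> proj_points"
        "U \<noteq> W" "\<not> R U W" "U' \<noteq> W'" "\<not> R U' W'" for U W U' W'
      using that by (intro transitive_not_perp) (auto simp: R_def)
    have sb': "B e1 f1 = 1" "B e2 f2 = 1" "B e1 e2 = 0" "B e1 f2 = 0" "B e2 f1 = 0"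
      using sb by (auto simp: symplectic_basis4_def)
    \<comment> \<open>The point \<open>p'\<close> is collinear with \<open>p\<close> and
      \<open>q\<close>, which are not collinear with each other. Adding \<open>f1\<close> and
      \<open>f2\<close> makes \<open>r\<close> non-orthogonal to both of the collinear points
      \<open>p\<close> and \<open>p'\<close>, which gives the path in the complement.\<close>
    define p where "p = vec.span {e1}"
    define p' where "p' = vec.span {e2}"
    define q where "q = vec.span {f1}"
    define r where "r = vec.span {f1 + f2}"
    have in_points: "p \<in> proj_points" "p' \<in> proj_points" "q \<in> proj_points" "r \<in> proj_points"
      using sb' nonzero[of e1 f1] nonzero[of e2 f2] nonzero[of e1 "f1 + f2"]
      by (auto simp: p_def p'_def q_def r_def B_simps intro!: span_proj_point)
    have perps: "perp p p'" "perp p' q" "\<not> perp p q" "\<not> perp p r" "\<not> perp p' r"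
      using sb' by (simp_all add: p_def p'_def q_def r_def perp_span B_simps)
    then have neq: "p \<noteq> q" "p \<noteq> r" "p' \<noteq> r" "p \<noteq> p'" "p' \<noteq> q"
      using perp_self in_points by auto
    show "\<exists>U\<in>proj_points. \<exists>W\<in>proj_points. \<exists>Y\<in>proj_points. R U W \<and> R W Y \<and> U \<noteq> Y \<and> \<not> R U Y"
      using in_points perps neq unfolding R_def by blast
    have "\<not> perp r p'" using perps perp_sym by blast
    then show "\<exists>U\<in>proj_points. \<exists>W\<in>proj_points. \<exists>Y\<in>proj_points. U \<noteq> W \<and> W \<noteq> Y \<and> \<not> R U W \<and> \<not> R W Y \<and> R U Y"
      using in_points perps neq unfolding R_def by metis
  qed
  then show ?thesis by (rule rank3_group.almost_synchronizing)
qed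

end

theorem theorem7p1:
  "(CARD('n::finite) \<ge> 5 \<longrightarrow>
      (\<forall>G :: (('k::{field,finite} ^ 'n) set \<Rightarrow> ('k ^ 'n) set) set.
         subgroup G (BijGroup subspaces) \<and> PSL \<subseteq> G \<and> G \<subseteq> PGammaL \<longrightarrow>
         almost_synchronizing proj_lines (action_on proj_lines G)))
   \<and>
   (\<forall>p :: nat. prime p \<and> odd p \<and> CARD('f::{field,finite}) = p\<^sup>2 \<longrightarrow>
      almost_synchronizing (UNIV :: 'f set) affine_square_group)
   \<and>
   (\<forall>(m :: nat) (B :: 'h::{field,finite} ^ 4 \<Rightarrow> 'h ^ 4 \<Rightarrow> 'h) e1 e2 f1 f2 S.
      m \<ge> 1 \<and> CARD('h) = 2 ^ m \<and> symplectic_form B \<and> symplectic_basis4 B e1 e2 f1 f2 \<and>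
      (\<forall>\<sigma>\<in>S. field_automorphism \<sigma>) \<longrightarrow>
      almost_synchronizing proj_points (action_on proj_points (PSp_adjoin B {e1, e2, f1, f2} S)))"
proof (intro conjI allI impI)
  fix G :: "(('k ^ 'n) set \<Rightarrow> ('k ^ 'n) set) set"
  assume "CARD('n) \<ge> 5" "subgroup G (BijGroup subspaces) \<and> PSL \<subseteq> G \<and> G \<subseteq> PGammaL"
  then show "almost_synchronizing proj_lines (action_on proj_lines G)"
    by (intro lines_almost_synchronizing) auto
next
  fix p :: nat assume p: "prime p \<and> odd p \<and> CARD('f) = p\<^sup>2"
  then obtain r where r: "p = 2 * r + 1" by (auto elim: oddE)
  \<comment> \<open>The square of an odd number is 1 modulo 4, and this is what makes -1 a square in
    the field.\<close>
  then have "CARD('f) - 1 = 4 * (r * r + r)" using p by (simp add: power2_eq_square algebra_simps)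
  moreover have "odd CARD('f)" using p by simp
  ultimately show "almost_synchronizing (UNIV :: 'f set) affine_square_group"
    by (intro affine_square_group_almost_synchronizing) simp_all
next
  fix m :: nat and B :: "'h ^ 4 \<Rightarrow> 'h ^ 4 \<Rightarrow> 'h" and e1 e2 f1 f2 and S :: "('h \<Rightarrow> 'h) set"
  assume *: "m \<ge> 1 \<and> CARD('h) = 2 ^ m \<and> symplectic_form B \<and> symplectic_basis4 B e1 e2 f1 f2 \<and>
    (\<forall>\<sigma>\<in>S. field_automorphism \<sigma>)"
  then interpret symplectic_space4 B by unfold_locales simp
  show "almost_synchronizing proj_points (action_on proj_points (PSp_adjoin B {e1, e2, f1, f2} S))"
    using * by (intro points_almost_synchronizing) simp_all
qed

end
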